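(* Let $X$ and $Y$ be locally compact spaces, neither of which is realcompact. If $(\mathscr{R}(X),\leq)$ and $(\mathscr{R}(Y),\leq)$ are order-isomorphic, then $(\beta X\setminus X)\setminus\mathrm{cl}_{\beta X}(\upsilon X\setminus X)$ and $(\beta Y\setminus Y)\setminus\mathrm{cl}_{\beta Y}(\upsilon Y\setminus Y)$ are homeomorphic.
   Context: All spaces are completely regular Hausdorff. $\beta X$ is the Stone–Čech compactification and $\upsilon X\subseteq\beta X$ the Hewitt realcompactification of $X$. An extension of $X$ is a space containing $X$ as a dense subspace; its remainder is $Y\setminus X$. Extensions are identified up to homeomorphisms fixing $X$ pointwise, and $Y\leq Y'$ means there is a continuous map $Y'\to Y$ fixing $X$ pointwise. A space is realcompact if it is homeomorphic to a closed subspace of a power of $\mathbb{R}$. $\mathscr{R}(X)$ denotes the set of all realcompact extensions of $X$ with compact remainder, partially ordered by $\leq$. *)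

theory Defs
  imports "HOL-Analysis.Analysis"
begin

definition is_extension :: "'a topology \<Rightarrow> 'b topology \<Rightarrow> ('a \<Rightarrow> 'b) \<Rightarrow> bool" where
  "is_extension X T e \<longleftrightarrow>
     embedding_map X T e \<and> T closure_of (e ` topspace X) = topspace T"

text \<open>Realcompact: homeomorphic to a closed subspace of a power of the reals.
 The index set is taken inside the type of real functions on the carrier type,
 which is large enough (any realcompact T embeds closed into R^C(T)).\<close>
definition realcompact_space :: "'b topology \<Rightarrow> bool" where
  "realcompact_space T \<longleftrightarrow>
     (\<exists>(I :: ('b \<Rightarrow> real) set) S. closedin (powertop_real I) S \<and>
        T homeomorphic_space subtopology (powertop_real I) S)"

definition ext_le :: "'a topology \<Rightarrow> ('b topology \<times> ('a \<Rightarrow> 'b)) \<Rightarrow> ('b topology \<times> ('a \<Rightarrow> 'b)) \<Rightarrow> bool" where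
  "ext_le X E E' \<longleftrightarrow>
     (\<exists>f. continuous_map (fst E') (fst E) f \<and> (\<forall>x\<in>topspace X. f (snd E' x) = snd E x))"

definition ext_equiv :: "'a topology \<Rightarrow> ('b topology \<times> ('a \<Rightarrow> 'b)) \<Rightarrow> ('b topology \<times> ('a \<Rightarrow> 'b)) \<Rightarrow> bool" where
  "ext_equiv X E E' \<longleftrightarrow>
     (\<exists>f. homeomorphic_map (fst E') (fst E) f \<and> (\<forall>x\<in>topspace X. f (snd E' x) = snd E x))"

text \<open>Representatives of the members of R(X): realcompact (completely regular Hausdorff)
 extensions of X with compact remainder.  Carriers are taken in the type 'a set set,
 which has cardinality 2^2^|'a|, enough to host every Hausdorff space having a dense
 copy of X.\<close>
definition RX :: "'a topology \<Rightarrow> ('a set set topology \<times> ('a \<Rightarrow> 'a set set)) set" where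
  "RX X = {(T, e). is_extension X T e \<and> Hausdorff_space T \<and> completely_regular_space T \<and>
                   realcompact_space T \<and> compactin T (topspace T - e ` topspace X)}"

text \<open>(R(X),\<le>) and (R(Y),\<le>) are order-isomorphic: a map on representatives inducing a
 well-defined bijection of identification classes that preserves and reflects \<le>.\<close>
definition R_order_isomorphic :: "'a topology \<Rightarrow> 'b topology \<Rightarrow> bool" where
  "R_order_isomorphic X Y \<longleftrightarrow>
     (\<exists>F. F ` RX X \<subseteq> RX Y \<and>
          (\<forall>a\<in>RX X. \<forall>b\<in>RX X. ext_equiv X a b \<longleftrightarrow> ext_equiv Y (F a) (F b)) \<and>
          (\<forall>a\<in>RX X. \<forall>b\<in>RX X. ext_le X a b \<longleftrightarrow> ext_le Y (F a) (F b)) \<and>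
          (\<forall>c\<in>RX Y. \<exists>a\<in>RX X. ext_equiv Y (F a) c))"

definition stone_cech :: "'a topology \<Rightarrow> 'c topology \<Rightarrow> ('a \<Rightarrow> 'c) \<Rightarrow> bool" where
  "stone_cech X B e \<longleftrightarrow> compact_space B \<and> Hausdorff_space B \<and> is_extension X B e \<and>
     (\<forall>f. continuous_map X euclideanreal f \<and> bounded (f ` topspace X) \<longrightarrow>
        (\<exists>g. continuous_map B euclideanreal g \<and> (\<forall>x\<in>topspace X. g (e x) = f x)))"

definition hewitt_set :: "'a topology \<Rightarrow> 'c topology \<Rightarrow> ('a \<Rightarrow> 'c) \<Rightarrow> 'c set" where
  "hewitt_set X B e = {p \<in> topspace B. \<forall>f. continuous_map X euclideanreal f \<longrightarrow>
      (\<exists>g. continuous_map (subtopology B (insert p (e ` topspace X))) euclideanreal g \<and>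
           (\<forall>x\<in>topspace X. g (e x) = f x))}"

end

theory Submission
  imports Defs
begin

text \<open>
  Put \<open>N = \<beta>X - X\<close> and \<open>K = cl (\<upsilon>X - X)\<close>; local compactness makes \<open>N\<close> closed in \<open>\<beta>X\<close>, and \<open>K\<close> is
  nonempty because \<open>X\<close> is not realcompact. A member \<open>T\<close> of \<open>\<R>(X)\<close> is a perfect image of \<open>X \<union> D\<close> for a
  unique closed \<open>D\<close> with \<open>K \<subseteq> D \<subseteq> N\<close>, so \<open>T\<close> is encoded by an equivalence relation on \<open>D\<close>, and \<open>T \<le> T'\<close>
  holds iff the relation of \<open>T'\<close> is contained in that of \<open>T\<close>. Every diagonal \<open>\<Delta>\<^sub>D\<close>, possibly with one
  further pair of points of \<open>D\<close> identified, arises in this way.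

  The points of \<open>N - K\<close> correspond to the elements with relation \<open>\<Delta>\<close> of \<open>K \<union> {x}\<close>, and these are
  characterised by the order alone: they are the middle elements of principal filters that are
  three-element chains (the bottom element being \<open>x\<close> glued to a point of \<open>K\<close>). The closed subsets of
  \<open>N - K\<close> are exactly the sets of such points lying above some member of \<open>\<R>(X)\<close>. Hence an order
  isomorphism induces a homeomorphism.
\<close>

section \<open>Recovering the topology from the order\<close>

definition greatest_elt :: "'e set \<Rightarrow> ('e \<Rightarrow> 'e \<Rightarrow> bool) \<Rightarrow> 'e \<Rightarrow> bool" where
  "greatest_elt A le E \<longleftrightarrow> E \<in> A \<and> (\<forall>G\<in>A. le G E)"

text \<open>A point \<open>x\<close> outside \<open>K\<close> can be glued to a point of \<open>K\<close>, giving a three-element chain above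
  (in the order of extensions) the glued element; an element that merely identifies two points
  of \<open>K\<close> is never the middle of such a chain.\<close>
definition point_elt :: "'e set \<Rightarrow> ('e \<Rightarrow> 'e \<Rightarrow> bool) \<Rightarrow> 'e \<Rightarrow> bool" where
  "point_elt A le E \<longleftrightarrow> E \<in> A \<and> \<not> greatest_elt A le E \<and>
     (\<exists>E'\<in>A. le E' E \<and> \<not> le E E' \<and>
        (\<forall>G\<in>A. le E' G \<longrightarrow> greatest_elt A le G \<or> (le G E \<and> le E G) \<or> le G E'))"

section \<open>Order-theoretic notions under isomorphisms of preorders\<close>

text \<open>In the application \<open>le\<close> is only a preorder and \<open>F\<close> acts on
  representatives, so surjectivity holds up to mutual comparability. Each \<open>c\<close> is
  replaced by an equivalent \<open>F a\<close>, and transitivity in \<open>A'\<close> carries the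
  comparisons over.\<close>

lemma greatest_elt_transfer:
  assumes F: "F ` A \<subseteq> A'" and emb: "\<And>a b. a \<in> A \<Longrightarrow> b \<in> A \<Longrightarrow> le a b \<longleftrightarrow> le' (F a) (F b)"
    and surj: "\<And>c. c \<in> A' \<Longrightarrow> \<exists>a\<in>A. le' (F a) c \<and> le' c (F a)"
    and tr: "\<And>a b c. a \<in> A' \<Longrightarrow> b \<in> A' \<Longrightarrow> c \<in> A' \<Longrightarrow> le' a b \<Longrightarrow> le' b c \<Longrightarrow> le' a c"
    and E: "E \<in> A"
  shows "greatest_elt A' le' (F E) \<longleftrightarrow> greatest_elt A le E"
proof
  assume "greatest_elt A' le' (F E)"
  then show "greatest_elt A le E"
    using F E emb unfolding greatest_elt_def by blast
next
  assume g: "greatest_elt A le E"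
  have "le' c (F E)" if c: "c \<in> A'" for c
  proof -
    obtain a where a: "a \<in> A" "le' c (F a)"
      using surj[OF c] by blast
    have "le' (F a) (F E)"
      using g a(1) emb E unfolding greatest_elt_def by blast
    with tr[of c "F a" "F E"] a c F E show ?thesis
      by blast
  qed
  then show "greatest_elt A' le' (F E)"
    using F E unfolding greatest_elt_def by blast
qed

text \<open>The notion is built from \<open>le\<close> alone, so the witness \<open>E'\<close> and
  every competitor \<open>G\<close> can be moved across \<open>F\<close>, again up to
  equivalence.\<close>

lemma point_elt_transfer:
  assumes F: "F ` A \<subseteq> A'" and emb: "\<And>a b. a \<in> A \<Longrightarrow> b \<in> A \<Longrightarrow> le a b \<longleftrightarrow> le' (F a) (F b)"
    and surj: "\<And>c. c \<in> A' \<Longrightarrow> \<exists>a\<in>A. le' (F a) c \<and> le' c (F a)"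
    and tr: "\<And>a b c. a \<in> A' \<Longrightarrow> b \<in> A' \<Longrightarrow> c \<in> A' \<Longrightarrow> le' a b \<Longrightarrow> le' b c \<Longrightarrow> le' a c"
    and E: "E \<in> A"
  shows "point_elt A' le' (F E) \<longleftrightarrow> point_elt A le E"
proof -
  have greatest: "greatest_elt A' le' (F G) \<longleftrightarrow> greatest_elt A le G" if "G \<in> A" for G
    using F emb surj tr that by (rule greatest_elt_transfer)
  have FA: "F a \<in> A'" if "a \<in> A" for a
    using F that by blast
  have gcong: "greatest_elt A' le' d"
    if "greatest_elt A' le' c" "le' c d" "d \<in> A'" for c d
    using that tr unfolding greatest_elt_def by blast
  show ?thesis
  proof
    assume p: "point_elt A' le' (F E)"
    then obtain c where c: "c \<in> A'" "le' c (F E)" "\<not> le' (F E) c"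
      "\<And>G. G \<in> A' \<Longrightarrow> le' c G \<Longrightarrow> greatest_elt A' le' G \<or> (le' G (F E) \<and> le' (F E) G) \<or> le' G c"
      unfolding point_elt_def by blast
    obtain a where a: "a \<in> A" "le' (F a) c" "le' c (F a)"
      using surj[OF c(1)] by blast
    have "le a E"
      using emb[OF a(1) E] tr[OF FA[OF a(1)] c(1) FA[OF E] a(2) c(2)] by simp
    moreover have "\<not> le E a"
      using emb[OF E a(1)] tr[OF FA[OF E] FA[OF a(1)] c(1) _ a(2)] c(3) by blast
    moreover have "greatest_elt A le G \<or> (le G E \<and> le E G) \<or> le G a"
      if G: "G \<in> A" "le a G" for G
    proof -
      have "le' c (F G)"
        using tr[OF c(1) FA[OF a(1)] FA[OF G(1)] a(3)] emb[OF a(1) G(1)] G(2) by blast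
      from c(4)[OF FA[OF G(1)] this]
      show ?thesis
        using greatest[OF G(1)] emb[OF G(1) E] emb[OF E G(1)] emb[OF G(1) a(1)]
          tr[OF FA[OF G(1)] c(1) FA[OF a(1)] _ a(3)] by blast
    qed
    moreover have "\<not> greatest_elt A le E"
      using p greatest[OF E] unfolding point_elt_def by blast
    ultimately show "point_elt A le E"
      using E a(1) unfolding point_elt_def by blast
  next
    assume p: "point_elt A le E"
    then obtain a where a: "a \<in> A" "le a E" "\<not> le E a"
      "\<And>G. G \<in> A \<Longrightarrow> le a G \<Longrightarrow> greatest_elt A le G \<or> (le G E \<and> le E G) \<or> le G a"
      unfolding point_elt_def by blast
    have "greatest_elt A' le' c \<or> (le' c (F E) \<and> le' (F E) c) \<or> le' c (F a)"
      if c: "c \<in> A'" "le' (F a) c" for c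
    proof -
      obtain G where G: "G \<in> A" "le' (F G) c" "le' c (F G)"
        using surj[OF c(1)] by blast
      have "le a G"
        using tr[OF FA[OF a(1)] c(1) FA[OF G(1)] c(2) G(3)] emb[OF a(1) G(1)] by blast
      from a(4)[OF G(1) this] consider "greatest_elt A le G" | "le G E" "le E G" | "le G a"
        by blast
      then show ?thesis
      proof cases
        case 1
        then show ?thesis
          using greatest[OF G(1)] gcong[OF _ G(2) c(1)] by blast
      next
        case 2
        then show ?thesis
          using emb[OF G(1) E] emb[OF E G(1)] tr[OF c(1) FA[OF G(1)] FA[OF E] G(3)]
            tr[OF FA[OF E] FA[OF G(1)] c(1) _ G(2)] by blast
      next
        case 3
        then show ?thesis
          using emb[OF G(1) a(1)] tr[OF c(1) FA[OF G(1)] FA[OF a(1)] G(3)] by blast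
      qed
    qed
    moreover have "\<not> greatest_elt A' le' (F E)"
      using p greatest[OF E] unfolding point_elt_def by blast
    moreover have "le' (F a) (F E)" "\<not> le' (F E) (F a)"
      using a emb E by auto
    ultimately show "point_elt A' le' (F E)"
      using FA[OF E] FA[OF a(1)] unfolding point_elt_def by blast
  qed
qed

section \<open>Preorders encoded by equivalence relations on closed sets\<close>

text \<open>\<open>R E\<close> is an equivalence relation on \<open>Domain (R E)\<close>, and the
  order is reversed inclusion; distinct elements may share a relation, so \<open>le\<close> need not
  be antisymmetric. Taking \<open>a = b\<close> in \<open>realize\<close> yields plain
  diagonals.\<close>

locale relation_order =
  fixes A :: "'e set" and le :: "'e \<Rightarrow> 'e \<Rightarrow> bool"
    and B :: "'c topology" and N K :: "'c set" and R :: "'e \<Rightarrow> ('c \<times> 'c) set"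
  assumes t1: "t1_space B"
    and N: "closedin B N" and K: "closedin B K" "K \<subseteq> N" "K \<noteq> {}"
    and le_iff: "\<And>E E'. E \<in> A \<Longrightarrow> E' \<in> A \<Longrightarrow> le E E' \<longleftrightarrow> R E' \<subseteq> R E"
    and R_sub: "\<And>E. E \<in> A \<Longrightarrow> R E \<subseteq> N \<times> N"
    and R_sym: "\<And>E. E \<in> A \<Longrightarrow> sym (R E)"
    and R_trans: "\<And>E. E \<in> A \<Longrightarrow> trans (R E)"
    and R_closed: "\<And>E. E \<in> A \<Longrightarrow> closedin B (Domain (R E))"
    and R_K: "\<And>E. E \<in> A \<Longrightarrow> Id_on K \<subseteq> R E"
    and realize: "\<And>D a b. closedin B D \<Longrightarrow> K \<subseteq> D \<Longrightarrow> D \<subseteq> N \<Longrightarrow> a \<in> D \<Longrightarrow> b \<in> D \<Longrightarrow>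
        \<exists>E\<in>A. R E = Id_on D \<union> {(a, b), (b, a)}"
begin

lemma R_refl:
  assumes "E \<in> A" "(p, q) \<in> R E"
  shows "(p, p) \<in> R E"
  using R_sym[OF assms(1)] R_trans[OF assms(1)] assms(2) by (meson symD transD)

lemma le_trans:
  assumes "a \<in> A" "b \<in> A" "c \<in> A" "le a b" "le b c"
  shows "le a c"
  using assms le_iff by blast

lemma realize_diagonal:
  assumes "closedin B D" "K \<subseteq> D" "D \<subseteq> N"
  obtains E where "E \<in> A" "R E = Id_on D"
proof -
  obtain k where "k \<in> D"
    using K assms by blast
  then obtain E where "E \<in> A" "R E = Id_on D \<union> {(k, k), (k, k)}"
    using realize[OF assms] by blast
  moreover have "Id_on D \<union> {(k, k), (k, k)} = Id_on D"
    using \<open>k \<in> D\<close> by auto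
  ultimately show ?thesis
    using that by metis
qed

lemma closedin_insert_K:
  assumes "x \<in> N"
  shows "closedin B (insert x K)" "K \<subseteq> insert x K" "insert x K \<subseteq> N"
proof -
  have "x \<in> topspace B"
    using assms N closedin_subset by blast
  then have "closedin B ({x} \<union> K)"
    using closedin_t1_singleton[OF t1] K(1) closedin_Un by blast
  then show "closedin B (insert x K)"
    by simp
qed (use assms K in auto)

text \<open>The smallest possible relation is the diagonal of \<open>K\<close>: it lies in every
  \<open>R E\<close> by \<open>R_K\<close>, and it is realized.\<close>

lemma greatest_elt_iff:
  assumes "E \<in> A"
  shows "greatest_elt A le E \<longleftrightarrow> R E = Id_on K"
proof -
  obtain E0 where E0: "E0 \<in> A" "R E0 = Id_on K"
    using realize_diagonal[OF K(1) subset_refl K(2)] by blast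
  have "greatest_elt A le E \<longleftrightarrow> (\<forall>G\<in>A. R E \<subseteq> R G)"
    unfolding greatest_elt_def using assms le_iff by blast
  also have "\<dots> \<longleftrightarrow> R E \<subseteq> Id_on K"
    using E0 R_K by blast
  also have "\<dots> \<longleftrightarrow> R E = Id_on K"
    using R_K[OF assms] by blast
  finally show ?thesis .
qed

text \<open>Gluing \<open>x\<close> to a point \<open>k\<close> of \<open>K\<close> leaves only
  three relations between the diagonal of \<open>K\<close> and the glued one, because a mixed pair
  forces its mirror image and \<open>(x, x)\<close>. Conversely, if the domain of
  \<open>R E'\<close> leaves \<open>K\<close>, a realized diagonal pins down \<open>R E\<close>; if
  not, a single realized pair contradicts the chain.\<close>

lemma point_elt_iff:
  assumes E: "E \<in> A"
  shows "point_elt A le E \<longleftrightarrow> (\<exists>x\<in>N - K. R E = Id_on (insert x K))"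
proof
  assume "\<exists>x\<in>N - K. R E = Id_on (insert x K)"
  then obtain x where x: "x \<in> N" "x \<notin> K" "R E = Id_on (insert x K)"
    by blast
  obtain k where k: "k \<in> K"
    using K by blast
  obtain E' where E': "E' \<in> A" "R E' = Id_on (insert x K) \<union> {(x, k), (k, x)}"
    using realize[OF closedin_insert_K[OF x(1)]] k by blast
  have "\<not> greatest_elt A le E"
    using greatest_elt_iff[OF E] x by auto
  moreover have "le E' E"
    using le_iff[OF E'(1) E] E'(2) x(3) by blast
  moreover have "\<not> le E E'"
    using le_iff[OF E E'(1)] E'(2) x k by auto
  moreover have "greatest_elt A le G \<or> (le G E \<and> le E G) \<or> le G E'"
    if G: "G \<in> A" "le E' G" for G
  proof -
    have sub: "R G \<subseteq> Id_on (insert x K) \<union> {(x, k), (k, x)}"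
      using G le_iff[OF E'(1) G(1)] E'(2) by blast
    show ?thesis
    proof (cases "(x, k) \<in> R G \<or> (k, x) \<in> R G")
      case True
      then have "(x, k) \<in> R G" "(k, x) \<in> R G" "(x, x) \<in> R G"
        using R_sym[OF G(1)] R_refl[OF G(1)] by (meson symD)+
      then have "R E' \<subseteq> R G"
        using E'(2) R_K[OF G(1)] by auto
      then show ?thesis
        using le_iff G E' by blast
    next
      case False
      then have sub': "R G \<subseteq> Id_on (insert x K)"
        using sub by blast
      show ?thesis
      proof (cases "(x, x) \<in> R G")
        case True
        then have "R G = R E"
          using sub' R_K[OF G(1)] x(3) by auto
        then show ?thesis
          using le_iff G E by blast
      next
        case False
        then have "R G = Id_on K"
          using sub' R_K[OF G(1)] by auto
        then show ?thesis
          using greatest_elt_iff G by blast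
      qed
    qed
  qed
  ultimately show "point_elt A le E"
    unfolding point_elt_def using E E'(1) by blast
next
  assume p: "point_elt A le E"
  then obtain E' where E': "E' \<in> A" "R E \<subseteq> R E'" "\<not> R E' \<subseteq> R E"
    and below: "\<And>G. G \<in> A \<Longrightarrow> R G \<subseteq> R E' \<Longrightarrow> R G = Id_on K \<or> R G = R E \<or> R G = R E'"
  proof -
    from p obtain E' where "E' \<in> A" "le E' E" "\<not> le E E'"
      "\<forall>G\<in>A. le E' G \<longrightarrow> greatest_elt A le G \<or> (le G E \<and> le E G) \<or> le G E'"
      unfolding point_elt_def by blast
    then show ?thesis
      using that[of E'] le_iff greatest_elt_iff E by blast
  qed
  have nE: "R E \<noteq> Id_on K"
    using p greatest_elt_iff[OF E] unfolding point_elt_def by blast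
  show "\<exists>x\<in>N - K. R E = Id_on (insert x K)"
  proof (cases "Domain (R E') \<subseteq> K")
    case False
    then obtain x where x: "x \<in> Domain (R E')" "x \<notin> K"
      by blast
    have xN: "x \<in> N"
      using x(1) R_sub[OF E'(1)] by blast
    obtain G where G: "G \<in> A" "R G = Id_on (insert x K)"
      using realize_diagonal[OF closedin_insert_K[OF xN]] by blast
    have "(x, x) \<in> R E'"
      using x(1) R_refl[OF E'(1)] by blast
    then have "R G \<subseteq> R E'"
      using G(2) R_K[OF E'(1)] by auto
    then consider "R G = Id_on K" | "R G = R E" | "R G = R E'"
      using below[OF G(1)] by blast
    then show ?thesis
    proof cases
      case 1
      then show ?thesis using G(2) x(2) by auto
    next
      case 2
      then show ?thesis using G(2) xN x(2) by auto
    next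
      case 3
      \<comment> \<open>\<open>R E\<close> is now a proper subset of a diagonal with just one point
        outside \<open>K\<close>, so it collapses to the diagonal of \<open>K\<close>.\<close>
      then have "R E \<subseteq> Id_on (insert x K)" "\<not> Id_on (insert x K) \<subseteq> R E"
        using G(2) E' by auto
      then have "R E = Id_on K"
        using R_K[OF E] by auto
      then show ?thesis using nE by blast
    qed
  next
    case True
    have EK: "c \<in> K" "d \<in> K" if "(c, d) \<in> R E'" for c d
      using that True R_sym[OF E'(1)] by (auto dest: symD)
    have pair: "\<exists>G\<in>A. R G = Id_on K \<union> {(c, d), (d, c)} \<and> R G \<subseteq> R E'"
      if cd: "(c, d) \<in> R E'" for c d
    proof -
      obtain G where G: "G \<in> A" "R G = Id_on K \<union> {(c, d), (d, c)}"
        using realize[OF K(1) subset_refl K(2) EK[OF cd]] by blast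
      have "(d, c) \<in> R E'"
        using cd R_sym[OF E'(1)] by (auto dest: symD)
      then have "R G \<subseteq> R E'"
        using cd R_K[OF E'(1)] G(2) by auto
      with G show ?thesis
        by blast
    qed
    \<comment> \<open>Gluing just \<open>u\<close> and \<open>v\<close> gives an element above
      \<open>E'\<close> that is neither greatest nor equivalent to \<open>E\<close>, so it has the
      relation of \<open>E'\<close>. The nontrivial pair \<open>(c, d)\<close> of \<open>R E\<close>
      must then be \<open>(u, v)\<close> up to order, although \<open>(u, v)\<close> is not in
      \<open>R E\<close>.\<close>
    obtain c d where cd: "(c, d) \<in> R E" "(c, d) \<notin> Id_on K"
      using nE R_K[OF E] by auto
    obtain u v where uv: "(u, v) \<in> R E'" "(u, v) \<notin> R E"
      using E'(3) by auto
    have dc: "(d, c) \<in> R E"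
      using cd(1) R_sym[OF E] by (auto dest: symD)
    obtain G where G: "G \<in> A" "R G = Id_on K \<union> {(u, v), (v, u)}" "R G \<subseteq> R E'"
      using pair[OF uv(1)] by blast
    have "(u, v) \<notin> Id_on K"
      using uv(2) R_K[OF E] by blast
    then have "R G = R E'"
      using below[OF G(1,3)] uv(2) G(2) by blast
    then have "(c, d) \<in> Id_on K \<union> {(u, v), (v, u)}"
      using cd(1) E'(2) G(2) by blast
    then have "(c, d) = (u, v) \<or> (d, c) = (u, v)"
      using cd(2) by auto
    then show ?thesis
      using cd(1) dc uv(2) by auto
  qed
qed

text \<open>Enlarging a closed subset of \<open>N\<close> by \<open>K\<close> makes its diagonal
  realizable, and restricting to \<open>N - K\<close> removes \<open>K\<close> again; the converse
  comes from \<open>R_closed\<close>.\<close>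

lemma closedin_remainder_iff:
  "closedin (subtopology B (N - K)) C \<longleftrightarrow> (\<exists>E\<in>A. C = {x \<in> N - K. (x, x) \<in> R E})"
proof
  assume "closedin (subtopology B (N - K)) C"
  then obtain D where D: "closedin B D" "C = D \<inter> (N - K)"
    by (auto simp: closedin_subtopology)
  have "closedin B (D \<inter> N \<union> K)"
    using D(1) N K(1) by blast
  then obtain E where "E \<in> A" "R E = Id_on (D \<inter> N \<union> K)"
    using realize_diagonal[of "D \<inter> N \<union> K"] K(2) by auto
  moreover have "C = {x \<in> N - K. (x, x) \<in> Id_on (D \<inter> N \<union> K)}"
    using D(2) by auto
  ultimately show "\<exists>E\<in>A. C = {x \<in> N - K. (x, x) \<in> R E}"
    by metis
next
  assume "\<exists>E\<in>A. C = {x \<in> N - K. (x, x) \<in> R E}"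
  then obtain E where E: "E \<in> A" "C = {x \<in> N - K. (x, x) \<in> R E}"
    by blast
  have "C = Domain (R E) \<inter> (N - K)"
    using E R_refl by blast
  then show "closedin (subtopology B (N - K)) C"
    using R_closed[OF E(1)] by (auto simp: closedin_subtopology)
qed

end

text \<open>The order recognizes the diagonals of \<open>insert x K\<close> through
  \<open>point_elt\<close>, so \<open>F\<close> moves points to points. Closed sets are read off
  from the order as well, hence the induced bijection is a homeomorphism.\<close>

lemma relation_order_isomorphic_imp_homeomorphic:
  assumes "relation_order A le B N K R" and "relation_order A' le' B' N' K' R'"
    and F: "F ` A \<subseteq> A'" and emb: "\<And>a b. a \<in> A \<Longrightarrow> b \<in> A \<Longrightarrow> le a b \<longleftrightarrow> le' (F a) (F b)"
    and surj: "\<And>c. c \<in> A' \<Longrightarrow> \<exists>a\<in>A. le' (F a) c \<and> le' c (F a)"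
  shows "subtopology B (N - K) homeomorphic_space subtopology B' (N' - K')"
proof -
  interpret A: relation_order A le B N K R by fact
  interpret A': relation_order A' le' B' N' K' R' by fact
  have FA: "F a \<in> A'" if "a \<in> A" for a
    using F that by blast
  have pt: "point_elt A' le' (F E) \<longleftrightarrow> point_elt A le E" if "E \<in> A" for E
    using F emb surj A'.le_trans that by (rule point_elt_transfer)
  have "\<forall>x. \<exists>E. x \<in> N - K \<longrightarrow> E \<in> A \<and> R E = Id_on (insert x K)"
    using A.realize_diagonal[OF A.closedin_insert_K] by (metis DiffD1)
  then obtain P where P: "\<And>x. x \<in> N - K \<Longrightarrow> P x \<in> A" "\<And>x. x \<in> N - K \<Longrightarrow> R (P x) = Id_on (insert x K)"
    by metis
  \<comment> \<open>\<open>F (P x)\<close> satisfies \<open>point_elt\<close> by invariance, and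
    \<open>h x\<close> will be the point that it represents.\<close>
  have "\<forall>x. \<exists>y. x \<in> N - K \<longrightarrow> y \<in> N' - K' \<and> R' (F (P x)) = Id_on (insert y K')"
    using P pt A.point_elt_iff A'.point_elt_iff FA by meson
  then obtain h where h: "\<And>x. x \<in> N - K \<Longrightarrow> h x \<in> N' - K'"
      "\<And>x. x \<in> N - K \<Longrightarrow> R' (F (P x)) = Id_on (insert (h x) K')"
    by metis
  have inj: "inj_on h (N - K)"
  proof (rule inj_onI)
    fix x y assume xy: "x \<in> N - K" "y \<in> N - K" "h x = h y"
    then have "R' (F (P x)) = R' (F (P y))"
      using h(2) by metis
    then have "le' (F (P x)) (F (P y))" "le' (F (P y)) (F (P x))"
      using A'.le_iff FA P(1) xy by auto
    then have "R (P x) = R (P y)"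
      using emb A.le_iff P(1) xy by (metis subset_antisym)
    then have "Id_on (insert x K) = Id_on (insert y K)"
      using P(2) xy by metis
    then show "x = y"
      using xy by auto
  qed
  have surjh: "y \<in> h ` (N - K)" if y: "y \<in> N' - K'" for y
  proof -
    obtain c where c: "c \<in> A'" "R' c = Id_on (insert y K')"
      using A'.realize_diagonal[OF A'.closedin_insert_K] y by blast
    obtain a where a: "a \<in> A" "le' (F a) c" "le' c (F a)"
      using surj[OF c(1)] by blast
    have Fa: "R' (F a) = Id_on (insert y K')"
      using a c A'.le_iff FA by blast
    then have "point_elt A le a"
      using pt[OF a(1)] A'.point_elt_iff[OF FA[OF a(1)]] y by blast
    then obtain x where x: "x \<in> N - K" "R a = Id_on (insert x K)"
      using A.point_elt_iff[OF a(1)] by blast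
    then have "le a (P x)" "le (P x) a"
      using A.le_iff[OF a(1)] A.le_iff[OF _ a(1)] P by auto
    then have "R' (F (P x)) = R' (F a)"
      using emb a(1) P(1)[OF x(1)] A'.le_iff FA by (metis subset_antisym)
    then have "Id_on (insert (h x) K') = Id_on (insert y K')"
      using h(2)[OF x(1)] Fa by simp
    then have "h x = y"
      using y h(1)[OF x(1)] by auto
    then show ?thesis
      using x by blast
  qed
  have im: "h ` (N - K) = N' - K'"
    using h(1) surjh by blast
  \<comment> \<open>Since \<open>Id_on K\<close> lies in \<open>R E\<close> anyway, membership of
    \<open>(x, x)\<close> says exactly that \<open>E\<close> is below \<open>P x\<close>, a
    statement that \<open>F\<close> preserves.\<close>
  have Z: "(x, x) \<in> R E \<longleftrightarrow> (h x, h x) \<in> R' (F E)" if x: "x \<in> N - K" and E: "E \<in> A" for x E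
  proof -
    have "(x, x) \<in> R E \<longleftrightarrow> le E (P x)"
      using A.le_iff[OF E P(1)[OF x]] P(2)[OF x] A.R_K[OF E] by auto
    also have "\<dots> \<longleftrightarrow> le' (F E) (F (P x))"
      using emb E P(1)[OF x] by blast
    also have "\<dots> \<longleftrightarrow> (h x, h x) \<in> R' (F E)"
      using A'.le_iff[OF FA[OF E] FA[OF P(1)[OF x]]] h(2)[OF x] A'.R_K[OF FA[OF E]] by auto
    finally show ?thesis .
  qed
  have NB: "N \<subseteq> topspace B" "N' \<subseteq> topspace B'"
    using A.N A'.N closedin_subset by auto
  then have top: "topspace (subtopology B (N - K)) = N - K" "topspace (subtopology B' (N' - K')) = N' - K'"
    by auto
  have "homeomorphic_map (subtopology B (N - K)) (subtopology B' (N' - K')) h"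
  proof (rule bijective_closed_imp_homeomorphic_map)
    show "continuous_map (subtopology B (N - K)) (subtopology B' (N' - K')) h"
      unfolding continuous_map_closedin top
    proof (intro conjI allI impI)
      show "h \<in> N - K \<rightarrow> N' - K'"
        using h(1) by blast
      fix C assume "closedin (subtopology B' (N' - K')) C"
      then obtain c where c: "c \<in> A'" "C = {x \<in> N' - K'. (x, x) \<in> R' c}"
        using A'.closedin_remainder_iff by blast
      obtain a where a: "a \<in> A" "le' (F a) c" "le' c (F a)"
        using surj[OF c(1)] by blast
      have "R' c = R' (F a)"
        using a c A'.le_iff FA by blast
      then have "{x \<in> N - K. h x \<in> C} = {x \<in> N - K. (x, x) \<in> R a}"
        using c(2) Z[OF _ a(1)] h(1) by auto
      then show "closedin (subtopology B (N - K)) {x \<in> N - K. h x \<in> C}"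
        using A.closedin_remainder_iff a(1) by blast
    qed
    show "closed_map (subtopology B (N - K)) (subtopology B' (N' - K')) h"
      unfolding closed_map_def
    proof (intro allI impI)
      fix C assume "closedin (subtopology B (N - K)) C"
      then obtain a where a: "a \<in> A" "C = {x \<in> N - K. (x, x) \<in> R a}"
        using A.closedin_remainder_iff by blast
      then have "h ` C = {y \<in> h ` (N - K). (y, y) \<in> R' (F a)}"
        using Z[OF _ a(1)] by auto
      then have "h ` C = {y \<in> N' - K'. (y, y) \<in> R' (F a)}"
        by (simp only: im)
      then show "closedin (subtopology B' (N' - K')) (h ` C)"
        using A'.closedin_remainder_iff FA[OF a(1)] by blast
    qed
  qed (use im inj top in auto)
  then show ?thesis
    by (rule homeomorphic_map_imp_homeomorphic_space)
qed

section \<open>Realcompactness and the Hewitt realcompactification\<close>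

text \<open>A closed set of \<open>T\<close> is the trace on the image of \<open>e\<close> of a
  closed set of \<open>B\<close>, so closure in \<open>B\<close> adds no further points of that
  image.\<close>

lemma embedding_map_in_closure_of_image:
  assumes e: "embedding_map T B e" and C: "closedin T C"
    and t: "t \<in> topspace T" and cl: "e t \<in> B closure_of (e ` C)"
  shows "t \<in> C"
proof -
  have h: "homeomorphic_map T (subtopology B (e ` topspace T)) e"
    using e by (simp add: embedding_map_def)
  have "closedin (subtopology B (e ` topspace T)) (e ` C)"
    using homeomorphic_map_closedness_eq[OF h] C by blast
  then obtain D where D: "closedin B D" "e ` C = D \<inter> e ` topspace T"
    by (auto simp: closedin_subtopology)
  have "B closure_of (e ` C) \<subseteq> D"
    by (rule closure_of_minimal) (use D in auto)
  with cl t D(2) have "e t \<in> e ` C"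
    by blast
  moreover have "inj_on e (topspace T)"
    using h by (rule homeomorphic_imp_injective_map)
  ultimately show ?thesis
    using t closedin_subset[OF C] by (auto dest: inj_onD)
qed

text \<open>All continuous real functions together embed \<open>T\<close> in a power of the reals. A
  limit \<open>r\<close> of the image of a closed \<open>C\<close> yields, by compactness of
  \<open>B\<close>, a cluster point \<open>p\<close>. If \<open>p\<close> were outside the image of
  \<open>T\<close>, the reciprocal of a function vanishing at \<open>p\<close> would be unbounded
  near \<open>p\<close> yet close to its coordinate in \<open>r\<close>. So \<open>p = e t\<close>,
  and then \<open>h t = r\<close>.\<close>

lemma realcompact_spaceI:
  fixes T :: "'t topology" and B :: "'b topology"
  assumes B: "compact_space B" "Hausdorff_space B" and e: "embedding_map T B e"
    and zero: "\<And>p. p \<in> topspace B - e ` topspace T \<Longrightarrow>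
      \<exists>k. continuous_map B euclideanreal k \<and> k p = 0 \<and> (\<forall>t\<in>topspace T. k (e t) \<noteq> 0)"
  shows "realcompact_space T"
proof -
  define I where "I = {g. continuous_map T euclideanreal g}"
  define h where "h = (\<lambda>t. \<lambda>g\<in>I. g t)"
  define P where "P = powertop_real I"
  have ce: "continuous_map T B e"
    using e embedding_map_def continuous_map_in_subtopology homeomorphic_imp_continuous_map by metis
  have conth: "continuous_map T P h"
    unfolding P_def h_def by (auto simp: continuous_map_componentwise I_def)
  have inje: "inj_on e (topspace T)"
    using e embedding_map_def homeomorphic_imp_injective_map by metis
  have etop: "e t \<in> topspace B" if "t \<in> topspace T" for t
    using ce that continuous_map_image_subset_topspace by blast
  have inj: "inj_on h (topspace T)"
  proof (rule inj_onI, rule ccontr)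
    fix s t assume st: "s \<in> topspace T" "t \<in> topspace T" "h s = h t" "s \<noteq> t"
    have n: "normal_space B"
      using B compact_Hausdorff_or_regular_imp_normal_space by blast
    have ne: "e s \<noteq> e t"
      using st inje by (auto dest: inj_onD)
    have cl: "closedin B {e s}" "closedin B {e t}"
      using B(2) st etop by (auto simp: closedin_Hausdorff_singleton)
    have "disjnt {e s} {e t}"
      using ne by simp
    from Urysohn_lemma_alt[OF n cl this, of 0 1]
    obtain f where f: "continuous_map B euclideanreal f" "f ` {e s} \<subseteq> {0}" "f ` {e t} \<subseteq> {1}"
      by blast
    have "f \<circ> e \<in> I"
      using continuous_map_compose[OF ce f(1)] by (simp add: I_def)
    with fun_cong[OF st(3), of "f \<circ> e"] f show False
      by (simp add: h_def)
  qed
  have clos: "closed_map T P h"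
    unfolding closed_map_def
  proof (intro allI impI)
    fix C assume C: "closedin T C"
    have CT: "C \<subseteq> topspace T"
      using C closedin_subset by blast
    have "r \<in> h ` C" if r: "r \<in> P closure_of (h ` C)" for r
    proof -
      have rP: "r \<in> topspace P"
        using r in_closure_of by metis
      \<comment> \<open>\<open>M W\<close> is the part of \<open>C\<close> mapped into the
        neighbourhood \<open>W\<close> of \<open>r\<close>; a point common to the closures of all
        these parts in \<open>B\<close> is the desired cluster point.\<close>
      define M where "M = (\<lambda>W. {t \<in> C. h t \<in> W})"
      define \<F> where "\<F> = {B closure_of (e ` M W) | W. openin P W \<and> r \<in> W}"
      have fip: "\<Inter>\<G> \<noteq> {}" if \<G>: "finite \<G>" "\<G> \<subseteq> \<F>" for \<G>
      proof -
        have "\<forall>G\<in>\<G>. \<exists>W. G = B closure_of (e ` M W) \<and> openin P W \<and> r \<in> W"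
          using \<G>(2) by (auto simp: \<F>_def)
        then obtain w where w: "\<And>G. G \<in> \<G> \<Longrightarrow> G = B closure_of (e ` M (w G)) \<and> openin P (w G) \<and> r \<in> w G"
          by metis
        have "openin P (topspace P \<inter> \<Inter>(w ` \<G>))"
          using \<G>(1) w by (intro openin_Int_Inter) auto
        moreover have "r \<in> topspace P \<inter> \<Inter>(w ` \<G>)"
          using rP w by auto
        ultimately obtain t where t: "t \<in> C" "h t \<in> \<Inter>(w ` \<G>)"
          using r unfolding in_closure_of by blast
        have "e t \<in> G" if "G \<in> \<G>" for G
        proof -
          have "e t \<in> e ` M (w G)"
            using t that by (auto simp: M_def)
          moreover have "e ` M (w G) \<subseteq> topspace B"
            using CT etop by (auto simp: M_def)
          ultimately show ?thesis
            using w[OF that] closure_of_subset by blast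
        qed
        then show ?thesis by blast
      qed
      have "\<Inter>\<F> \<noteq> {}"
      proof -
        have "\<forall>C\<in>\<F>. closedin B C" by (auto simp: \<F>_def)
        then show ?thesis
          using B(1) fip unfolding compact_space_fip by blast
      qed
      then obtain p where p: "\<And>W. openin P W \<Longrightarrow> r \<in> W \<Longrightarrow> p \<in> B closure_of (e ` M W)"
        by (auto simp: \<F>_def)
      have pB: "p \<in> topspace B"
        using p[of "topspace P"] rP in_closure_of by (metis openin_topspace)
      define W where "W = (\<lambda>g \<epsilon>. {s \<in> topspace P. s g \<in> ball (r g) \<epsilon>})"
      have W: "openin P (W g \<epsilon>)" "r \<in> W g \<epsilon>" if "g \<in> I" "\<epsilon> > 0" for g and \<epsilon> :: real
      proof -
        have "continuous_map P euclideanreal (\<lambda>s. s g)"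
          unfolding P_def using that by (intro continuous_map_product_projection)
        then show "openin P (W g \<epsilon>)"
          unfolding W_def by (rule openin_continuous_map_preimage) simp
        show "r \<in> W g \<epsilon>"
          using rP that by (simp add: W_def)
      qed
      have MW: "t \<in> C" "\<bar>g t - r g\<bar> < \<epsilon>" if "t \<in> M (W g \<epsilon>)" "g \<in> I" for t g \<epsilon>
        using that by (auto simp: M_def W_def h_def dist_real_def)
      show ?thesis
      proof (cases "p \<in> e ` topspace T")
        case False
        then obtain k where k: "continuous_map B euclideanreal k" "k p = 0"
          "\<forall>t\<in>topspace T. k (e t) \<noteq> 0"
          using zero pB by blast
        \<comment> \<open>The coordinate \<open>g\<close> stays within distance 1 of
          \<open>r g\<close> on \<open>M (W g 1)\<close>. This bounds the absolute value of
          \<open>k\<close> away from 0 there and, by closure, at \<open>p\<close>.\<close>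
        define g where "g = (\<lambda>t. inverse (k (e t)))"
        have gI: "g \<in> I"
          unfolding I_def g_def using continuous_map_compose[OF ce k(1)] k(3)
          by (auto intro!: continuous_map_real_inverse simp: o_def)
        define c where "c = \<bar>r g\<bar> + 1"
        have big: "inverse c \<le> \<bar>k (e t)\<bar>" if "t \<in> M (W g 1)" for t
        proof -
          have "\<bar>g t\<bar> \<le> c"
            using MW(2)[OF that gI] by (simp add: c_def)
          moreover have "k (e t) \<noteq> 0"
            using MW(1)[OF that gI] CT k(3) by blast
          ultimately show ?thesis
            using le_imp_inverse_le[of "\<bar>g t\<bar>" c] by (simp add: g_def abs_inverse)
        qed
        have top: "e t \<in> topspace B" if "t \<in> M (W g 1)" for t
          using MW(1)[OF that gI] CT etop by blast
        have "closedin B {q \<in> topspace B. \<bar>k q\<bar> \<in> {inverse c..}}"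
          using continuous_map_real_abs[OF k(1)] by (rule closedin_continuous_map_preimage) simp
        then have "B closure_of (e ` M (W g 1)) \<subseteq> {q \<in> topspace B. \<bar>k q\<bar> \<in> {inverse c..}}"
          by (rule closure_of_minimal[rotated]) (use big top in auto)
        with p[OF W[OF gI zero_less_one]] k(2) have "inverse c \<le> 0"
          by auto
        then show ?thesis
          by (simp add: c_def)
      next
        case True
        then obtain t where t: "t \<in> topspace T" "p = e t"
          by blast
        \<comment> \<open>Because \<open>p = e t\<close> lies in the closure of each trace,
          \<open>t\<close> belongs to every closed set containing some \<open>M V\<close>. This is
          applied to \<open>C\<close> and to preimages of closed balls around
          \<open>r g\<close>.\<close>
        have *: "t \<in> D" if "closedin T D" "openin P V" "r \<in> V" "M V \<subseteq> D" for D V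
        proof (rule embedding_map_in_closure_of_image[OF e that(1) t(1)])
          show "e t \<in> B closure_of (e ` D)"
            using p[OF that(2,3)] closure_of_mono[OF image_mono[OF that(4)], of B e] t(2) by blast
        qed
        have "t \<in> C"
          by (rule *[OF C openin_topspace rP]) (auto simp: M_def)
        moreover have "h t = r"
        proof
          fix g show "h t g = r g"
          proof (cases "g \<in> I")
            case True
            have "\<bar>g t - r g\<bar> \<le> \<epsilon>" if "\<epsilon> > 0" for \<epsilon>
            proof -
              have "closedin T {s \<in> topspace T. g s \<in> cball (r g) \<epsilon>}"
                by (rule closedin_continuous_map_preimage[where Y = euclideanreal]) (use True in \<open>auto simp: I_def\<close>)
              then have "t \<in> {s \<in> topspace T. g s \<in> cball (r g) \<epsilon>}"
                by (rule *[OF _ W[OF True that]])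
                  (use MW[OF _ True] CT in \<open>force simp: dist_real_def\<close>)
              then show ?thesis
                by (simp add: dist_real_def abs_minus_commute)
            qed
            then have "\<bar>g t - r g\<bar> \<le> 0"
              by (rule field_le_epsilon) simp
            then show ?thesis
              using True by (simp add: h_def)
          next
            case False
            \<comment> \<open>Off the index set both sides have the default value
              \<open>undefined\<close> of extensional functions.\<close>
            then show ?thesis
              using rP by (auto simp: h_def P_def PiE_def extensional_def)
          qed
        qed
        ultimately show ?thesis by blast
      qed
    qed
    moreover have "h ` C \<subseteq> topspace P"
      using CT conth continuous_map_image_subset_topspace by blast
    ultimately show "closedin P (h ` C)"
      using closure_of_subset_eq by blast
  qed
  have "embedding_map T P h"
    using conth clos inj by (rule injective_closed_imp_embedding_map)
  then have "T homeomorphic_space subtopology P (h ` topspace T)"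
    by (rule embedding_map_imp_homeomorphic_space)
  moreover have "closedin P (h ` topspace T)"
    using clos closed_map_def closedin_topspace by blast
  ultimately show ?thesis
    unfolding realcompact_space_def P_def by blast
qed

text \<open>If the extension \<open>v\<close> of \<open>1 / (1 + \<bar>f\<bar>)\<close> does not vanish at \<open>p\<close>, then \<open>u / v\<close>, with \<open>u\<close> extending
  \<open>f / (1 + \<bar>f\<bar>)\<close>, extends \<open>f\<close> to \<open>p\<close>.\<close>
lemma not_in_hewitt_set_imp_zero:
  assumes sc: "stone_cech X B i" and p: "p \<in> topspace B" "p \<notin> hewitt_set X B i"
  obtains k where "continuous_map B euclideanreal k" "k p = 0" "\<And>x. x \<in> topspace X \<Longrightarrow> k (i x) \<noteq> 0"
proof -
  obtain f where f: "continuous_map X euclideanreal f"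
    and nf: "\<And>g. continuous_map (subtopology B (insert p (i ` topspace X))) euclideanreal g \<Longrightarrow>
           \<not> (\<forall>x\<in>topspace X. g (i x) = f x)"
    using p unfolding hewitt_set_def by blast
  have ext: "\<exists>g. continuous_map B euclideanreal g \<and> (\<forall>x\<in>topspace X. g (i x) = u x)"
    if "continuous_map X euclideanreal u" "bounded (u ` topspace X)" for u
    using sc that unfolding stone_cech_def by blast
  have pos: "1 + \<bar>f x\<bar> \<noteq> 0" for x
    using abs_ge_zero[of "f x"] by linarith
  have "continuous_map X euclideanreal (\<lambda>x. 1 / (1 + \<bar>f x\<bar>))"
    using pos f by (intro continuous_intros continuous_map_real_divide continuous_map_add) auto
  moreover have "bounded ((\<lambda>x. 1 / (1 + \<bar>f x\<bar>)) ` topspace X)"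
    unfolding bounded_iff by (rule exI[of _ 1]) auto
  ultimately obtain v where v: "continuous_map B euclideanreal v"
      "\<And>x. x \<in> topspace X \<Longrightarrow> v (i x) = 1 / (1 + \<bar>f x\<bar>)"
    using ext by blast
  have "continuous_map X euclideanreal (\<lambda>x. f x / (1 + \<bar>f x\<bar>))"
    using pos f by (intro continuous_intros continuous_map_real_divide continuous_map_add) auto
  moreover have "bounded ((\<lambda>x. f x / (1 + \<bar>f x\<bar>)) ` topspace X)"
    unfolding bounded_iff by (rule exI[of _ 1]) auto
  ultimately obtain u where u: "continuous_map B euclideanreal u"
      "\<And>x. x \<in> topspace X \<Longrightarrow> u (i x) = f x / (1 + \<bar>f x\<bar>)"
    using ext by blast
  have vX: "v (i x) \<noteq> 0" if "x \<in> topspace X" for x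
    using v(2)[OF that] pos[of x] by simp
  have "v p = 0"
  proof (rule ccontr)
    assume "v p \<noteq> 0"
    then have "continuous_map (subtopology B (insert p (i ` topspace X))) euclideanreal (\<lambda>q. u q / v q)"
      using u(1) v(1) vX by (intro continuous_map_real_divide continuous_map_from_subtopology) auto
    moreover have "u (i x) / v (i x) = f x" if "x \<in> topspace X" for x
      using u(2)[OF that] v(2)[OF that] pos[of x] by simp
    ultimately show False
      using nf by blast
  qed
  then show ?thesis
    using v(1) vX that by blast
qed

section \<open>Extensions as perfect images\<close>

text \<open>For \<open>T\<close> an extension of \<open>X\<close>, \<open>S\<close> is the preimage of \<open>T\<close> under the canonical map \<open>\<beta>X \<rightarrow> \<beta>T\<close>, and
  \<open>\<psi>\<close> is the restriction of that map; perfectness of \<open>\<psi>\<close> determines both without mentioning \<open>\<beta>T\<close>.\<close>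
definition resolution ::
  "'a topology \<Rightarrow> 'c topology \<Rightarrow> ('a \<Rightarrow> 'c) \<Rightarrow> 'b topology \<Rightarrow> ('a \<Rightarrow> 'b) \<Rightarrow> 'c set \<Rightarrow> ('c \<Rightarrow> 'b) \<Rightarrow> bool" where
  "resolution X B i T e S \<psi> \<longleftrightarrow> i ` topspace X \<subseteq> S \<and> S \<subseteq> topspace B \<and>
     perfect_map (subtopology B S) T \<psi> \<and> (\<forall>x\<in>topspace X. \<psi> (i x) = e x)"

text \<open>The final topology on the image, for an arbitrary target type, so that quotients of the
  compactification can live on the codes given by \<open>trace_code\<close>.\<close>

lemma quotient_topology_exists:
  fixes f :: "'a \<Rightarrow> 'b"
  obtains Q where "quotient_map B Q f"
proof -
  define Q where "Q = topology (\<lambda>U. U \<subseteq> f ` topspace B \<and> openin B {p \<in> topspace B. f p \<in> U})"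
  have "istopology (\<lambda>U. U \<subseteq> f ` topspace B \<and> openin B {p \<in> topspace B. f p \<in> U})"
    unfolding istopology_def
  proof (intro conjI allI impI)
    fix U V
    assume "U \<subseteq> f ` topspace B \<and> openin B {p \<in> topspace B. f p \<in> U}"
      and "V \<subseteq> f ` topspace B \<and> openin B {p \<in> topspace B. f p \<in> V}"
    then show "U \<inter> V \<subseteq> f ` topspace B" "openin B {p \<in> topspace B. f p \<in> U \<inter> V}"
      using openin_Int[of B "{p \<in> topspace B. f p \<in> U}" "{p \<in> topspace B. f p \<in> V}"]
      by (auto simp: Collect_conj_eq[symmetric] Int_def conj_ac cong: conj_cong elim!: back_subst[of "openin B"])
  next
    fix \<K> assume \<K>: "\<forall>U\<in>\<K>. U \<subseteq> f ` topspace B \<and> openin B {p \<in> topspace B. f p \<in> U}"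
    then show "\<Union>\<K> \<subseteq> f ` topspace B" by blast
    have "{p \<in> topspace B. f p \<in> \<Union>\<K>} = (\<Union>U\<in>\<K>. {p \<in> topspace B. f p \<in> U})"
      by blast
    then show "openin B {p \<in> topspace B. f p \<in> \<Union>\<K>}"
      using \<K> by auto
  qed
  then have Q: "openin Q U \<longleftrightarrow> U \<subseteq> f ` topspace B \<and> openin B {p \<in> topspace B. f p \<in> U}" for U
    by (simp add: Q_def topology_inverse')
  have "{p \<in> topspace B. f p \<in> f ` topspace B} = topspace B"
    by blast
  then have "openin Q (f ` topspace B)"
    by (simp add: Q)
  then have "topspace Q = f ` topspace B"
    using Q by (meson openin_subset openin_topspace subset_antisym)
  then have "quotient_map B Q f"
    unfolding quotient_map_def using Q by auto
  then show ?thesis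
    by (rule that)
qed

section \<open>Resolutions over the Stone-Cech compactification\<close>

locale stone_cech_compactification =
  fixes X :: "'a topology" and B :: "'c topology" and i :: "'a \<Rightarrow> 'c"
  assumes stone_cech: "stone_cech X B i"
begin

lemma compact: "compact_space B" and Hausdorff: "Hausdorff_space B"
  and emb: "embedding_map X B i" and dense: "B closure_of (i ` topspace X) = topspace B"
  using stone_cech by (auto simp: stone_cech_def is_extension_def)

lemma normal: "normal_space B"
  using compact Hausdorff compact_Hausdorff_or_regular_imp_normal_space by blast

lemma homeo: "homeomorphic_map X (subtopology B (i ` topspace X)) i"
  using emb by (simp add: embedding_map_def)

lemma cont: "continuous_map X B i"
  using homeo continuous_map_in_subtopology homeomorphic_imp_continuous_map by blast

lemma image_subset: "i ` topspace X \<subseteq> topspace B"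
  using cont by (rule continuous_map_image_subset_topspace)

lemma extend:
  assumes "continuous_map X euclideanreal f" "bounded (f ` topspace X)"
  obtains g where "continuous_map B euclideanreal g" "\<And>x. x \<in> topspace X \<Longrightarrow> g (i x) = f x"
  using stone_cech assms unfolding stone_cech_def by blast

lemma dense_subtopology:
  assumes "i ` topspace X \<subseteq> S" "S \<subseteq> topspace B"
  shows "subtopology B S closure_of (i ` topspace X) = S"
  using assms dense by (simp add: closure_of_subtopology inf.absorb1 inf.absorb2)

text \<open>A perfect map into a Hausdorff space has no continuous extension to a larger space in which its
  domain is dense.\<close>
lemma extension_eq_resolution:
  assumes res: "resolution X B i T e S \<psi>" and T: "Hausdorff_space T"
    and S': "i ` topspace X \<subseteq> S'" "S' \<subseteq> topspace B"
    and \<phi>: "continuous_map (subtopology B S') T \<phi>" "\<And>x. x \<in> topspace X \<Longrightarrow> \<phi> (i x) = e x"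
  shows "S' \<subseteq> S" "\<And>p. p \<in> S' \<Longrightarrow> \<phi> p = \<psi> p"
proof -
  have S: "i ` topspace X \<subseteq> S" "S \<subseteq> topspace B" and \<psi>X: "\<And>x. x \<in> topspace X \<Longrightarrow> \<psi> (i x) = e x"
    and perf: "perfect_map (subtopology B S) T \<psi>"
    using res by (auto simp: resolution_def)
  show sub: "S' \<subseteq> S"
  proof (rule ccontr)
    assume "\<not> S' \<subseteq> S"
    then obtain p where p: "p \<in> S'" "p \<notin> S"
      by blast
    \<comment> \<open>\<open>L\<close> is the fibre of \<open>\<psi>\<close> over
      \<open>\<phi> p\<close>, compact by properness and not containing \<open>p\<close>. After
      separating the two, closedness of \<open>\<psi>\<close> and density of \<open>X\<close>
      produce a point of \<open>X\<close> in both disjoint neighbourhoods.\<close>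
    define L where "L = {q \<in> topspace (subtopology B S). \<psi> q = \<phi> p}"
    have \<phi>p: "\<phi> p \<in> topspace T"
      using \<phi>(1) p(1) S'(2) by (auto simp: continuous_map_def Pi_iff)
    have proper: "proper_map (subtopology B S) T \<psi>"
      using perf by (rule perfect_imp_proper_map)
    then have "compactin (subtopology B S) L"
      using \<phi>p unfolding L_def proper_map_def by blast
    then have "compactin B L" "L \<subseteq> S"
      by (auto simp: compactin_subtopology)
    moreover have "compactin B {p}"
      using p S' by auto
    moreover have "disjnt {p} L"
      using p(2) \<open>L \<subseteq> S\<close> by auto
    ultimately obtain U V where UV: "openin B U" "openin B V" "{p} \<subseteq> U" "L \<subseteq> V" "disjnt U V"
      using Hausdorff Hausdorff_space_compact_sets by metis
    have "openin (subtopology B S) (S \<inter> V)"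
      using UV(2) by (simp add: openin_subtopology_Int2)
    moreover have "L \<subseteq> S \<inter> V"
      using UV(4) \<open>L \<subseteq> S\<close> by blast
    ultimately obtain W where W: "openin T W" "\<phi> p \<in> W"
      "{q \<in> topspace (subtopology B S). \<psi> q \<in> W} \<subseteq> S \<inter> V"
      using proper_imp_closed_map[OF proper] \<phi>p unfolding closed_map_fibre_neighbourhood L_def by blast
    have "openin (subtopology B S') {q \<in> topspace (subtopology B S'). \<phi> q \<in> W}"
      using \<phi>(1) W(1) by (rule openin_continuous_map_preimage)
    then obtain G where G: "openin B G" "{q \<in> topspace (subtopology B S'). \<phi> q \<in> W} = G \<inter> S'"
      by (auto simp: openin_subtopology)
    have "p \<in> G"
      using G(2) p(1) S'(2) W(2) by auto
    then have "openin B (G \<inter> U)" "p \<in> G \<inter> U"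
      using G(1) UV by auto
    moreover have "p \<in> B closure_of (i ` topspace X)"
      using dense p(1) S'(2) by blast
    ultimately obtain x where x: "x \<in> topspace X" "i x \<in> G" "i x \<in> U"
      unfolding in_closure_of by blast
    have "\<phi> (i x) \<in> W"
      using G(2) x S'(1) by blast
    then have "i x \<in> S \<inter> V"
      using W(3) \<phi>(2)[OF x(1)] \<psi>X[OF x(1)] x(1) S by (auto simp: image_subset_iff subset_iff)
    then show False
      using UV(5) x(3) by (auto simp: disjnt_iff)
  qed
  show "\<phi> p = \<psi> p" if "p \<in> S'" for p
  proof (rule forall_in_closure_of_eq[where X = "subtopology B S'" and S = "i ` topspace X" and Y = T])
    show "p \<in> subtopology B S' closure_of i ` topspace X"
      using dense_subtopology[OF S'] that by simp
    have "continuous_map (subtopology (subtopology B S) S') T \<psi>"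
      using perfect_imp_continuous_map[OF perf] by (rule continuous_map_from_subtopology)
    then show "continuous_map (subtopology B S') T \<psi>"
      using sub by (simp add: subtopology_subtopology inf.absorb2)
  qed (use T \<phi> \<psi>X in auto)
qed

lemma resolution_unique:
  assumes "resolution X B i T e S \<psi>" "resolution X B i T e S' \<psi>'" "Hausdorff_space T"
  shows "S = S'" "\<And>p. p \<in> S \<Longrightarrow> \<psi> p = \<psi>' p"
proof -
  have "i ` topspace X \<subseteq> S" "S \<subseteq> topspace B" "continuous_map (subtopology B S) T \<psi>"
      "\<And>x. x \<in> topspace X \<Longrightarrow> \<psi> (i x) = e x"
    using assms(1) perfect_imp_continuous_map unfolding resolution_def by blast+
  from extension_eq_resolution[OF assms(2,3) this]
  have 1: "S \<subseteq> S'" "\<And>p. p \<in> S \<Longrightarrow> \<psi> p = \<psi>' p"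
    by blast+
  have "i ` topspace X \<subseteq> S'" "S' \<subseteq> topspace B" "continuous_map (subtopology B S') T \<psi>'"
      "\<And>x. x \<in> topspace X \<Longrightarrow> \<psi>' (i x) = e x"
    using assms(2) perfect_imp_continuous_map unfolding resolution_def by blast+
  from extension_eq_resolution(1)[OF assms(1,3) this] 1 show "S = S'"
    by blast
  show "\<psi> p = \<psi>' p" if "p \<in> S" for p
    using 1(2) that by blast
qed

text \<open>The coordinates of \<open>X\<close> in a cube containing \<open>T\<close> are bounded
  and extend over \<open>B\<close>. \<open>S\<close> is the preimage of the copy of \<open>T\<close>
  under the extended map, and a proper map stays proper when restricted to a full preimage.\<close>

lemma resolution_exists:
  fixes T :: "'b topology"
  assumes ext: "is_extension X T e" and T: "completely_regular_space T" "Hausdorff_space T"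
  obtains S \<psi> where "resolution X B i T e S \<psi>"
proof -
  obtain J :: "('b \<Rightarrow> real) set" and j
    where j0: "embedding_map T (product_topology (\<lambda>f. top_of_set {0..1::real}) J) j"
    using completely_regular_space_cube_embedding[OF T] by blast
  define P where "P = powertop_real J"
  \<comment> \<open>The cube is placed in a full power of the reals because \<open>extend\<close>
    delivers real-valued coordinates.\<close>
  have "product_topology (\<lambda>f. top_of_set {0..1::real}) J = subtopology P (PiE J (\<lambda>_. {0..1}))"
    by (simp add: P_def subtopology_product_topology)
  then have j: "embedding_map T P j" and j01: "j ` topspace T \<subseteq> PiE J (\<lambda>_. {0..1})"
    using j0 by (auto simp: embedding_map_in_subtopology)
  obtain j' where j': "homeomorphic_maps T (subtopology P (j ` topspace T)) j j'"
    using j unfolding embedding_map_def homeomorphic_map_maps by blast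
  have cj: "continuous_map T P j"
    using j' unfolding homeomorphic_maps_def continuous_map_in_subtopology by blast
  have ee: "embedding_map X T e" "T closure_of (e ` topspace X) = topspace T"
    using ext by (auto simp: is_extension_def)
  then have ce: "continuous_map X T e"
    using embedding_map_def continuous_map_in_subtopology homeomorphic_imp_continuous_map by metis
  have eT: "e x \<in> topspace T" if "x \<in> topspace X" for x
    using that ce by (auto simp: continuous_map_def Pi_iff)
  have "\<exists>g. continuous_map B euclideanreal g \<and> (\<forall>x\<in>topspace X. g (i x) = j (e x) k)" if k: "k \<in> J" for k
  proof -
    have "continuous_map X P (j \<circ> e)"
      using ce cj by (rule continuous_map_compose)
    then have "continuous_map X euclideanreal (\<lambda>x. j (e x) k)"
      using k unfolding P_def by (simp add: continuous_map_componentwise o_def)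
    moreover have "(\<lambda>x. j (e x) k) ` topspace X \<subseteq> {0..1}"
    proof clarify
      fix x assume "x \<in> topspace X"
      then have "j (e x) \<in> PiE J (\<lambda>_. {0..1})"
        using j01 eT by blast
      then show "j (e x) k \<in> {0..1}"
        using k by (rule PiE_mem)
    qed
    then have "bounded ((\<lambda>x. j (e x) k) ` topspace X)"
      using bounded_closed_interval bounded_subset by blast
    ultimately show ?thesis
      using extend by metis
  qed
  then obtain g where g: "\<And>k. k \<in> J \<Longrightarrow> continuous_map B euclideanreal (g k)"
    "\<And>k x. k \<in> J \<Longrightarrow> x \<in> topspace X \<Longrightarrow> g k (i x) = j (e x) k"
    by metis
  define \<Phi> where "\<Phi> = (\<lambda>p. \<lambda>k\<in>J. g k p)"
  have c\<Phi>: "continuous_map B P \<Phi>"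
    unfolding P_def \<Phi>_def using g(1) by (auto simp: continuous_map_componentwise)
  have \<Phi>X: "\<Phi> (i x) = j (e x)" if "x \<in> topspace X" for x
  proof
    fix k
    have "j (e x) \<in> PiE J (\<lambda>_. {0..1})"
      using j01 eT[OF that] by blast
    then show "\<Phi> (i x) k = j (e x) k"
      unfolding \<Phi>_def using g(2)[OF _ that] by (cases "k \<in> J") (simp_all add: PiE_iff extensional_def)
  qed
  have HP: "Hausdorff_space P"
    unfolding P_def by (simp add: Hausdorff_space_product_topology)
  define S where "S = {p \<in> topspace B. \<Phi> p \<in> j ` topspace T}"
  have "proper_map B P \<Phi>"
    using compact HP c\<Phi> by (intro continuous_imp_proper_map Hausdorff_imp_kc_space) auto
  then have proper: "proper_map (subtopology B S) (subtopology P (j ` topspace T)) \<Phi>"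
    by (rule proper_map_restriction) (simp add: S_def)
  have S: "i ` topspace X \<subseteq> S" "S \<subseteq> topspace B"
    using image_subset \<Phi>X eT by (auto simp: S_def)
  \<comment> \<open>The image of the compact \<open>B\<close> is closed and contains the dense copy
    of \<open>X\<close>, hence all of the copy of \<open>T\<close>; this gives surjectivity.\<close>
  have "closedin P (\<Phi> ` topspace B)"
    using \<open>proper_map B P \<Phi>\<close> proper_imp_closed_map closed_map_def closedin_topspace by blast
  then have "P closure_of (j ` e ` topspace X) \<subseteq> \<Phi> ` topspace B"
    by (rule closure_of_minimal[rotated]) (use \<Phi>X image_subset in force)
  moreover have "j ` topspace T \<subseteq> P closure_of (j ` e ` topspace X)"
    using continuous_map_image_closure_subset[OF cj, of "e ` topspace X"] ee(2) by simp
  ultimately have "j ` topspace T \<subseteq> \<Phi> ` topspace B"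
    by (rule order_trans[rotated])
  have im: "\<Phi> ` S = j ` topspace T"
  proof (intro equalityI subsetI)
    fix y assume y: "y \<in> j ` topspace T"
    then obtain p where "p \<in> topspace B" "y = \<Phi> p"
      using \<open>j ` topspace T \<subseteq> \<Phi> ` topspace B\<close> by (elim subsetD[THEN imageE])
    with y show "y \<in> \<Phi> ` S"
      by (simp add: S_def)
  qed (auto simp: S_def)
  have h': "homeomorphic_map (subtopology P (j ` topspace T)) T j'"
    using j' homeomorphic_maps_sym homeomorphic_maps_map by blast
  have "perfect_map (subtopology B S) T (j' \<circ> \<Phi>)"
    unfolding perfect_map_def
  proof (intro conjI)
    show "continuous_map (subtopology B S) T (j' \<circ> \<Phi>)"
    proof (rule continuous_map_compose)
      show "continuous_map (subtopology B S) (subtopology P (j ` topspace T)) \<Phi>"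
        using c\<Phi> im S(2) by (auto simp: continuous_map_in_subtopology continuous_map_from_subtopology)
      show "continuous_map (subtopology P (j ` topspace T)) T j'"
        using h' by (rule homeomorphic_imp_continuous_map)
    qed
    show "proper_map (subtopology B S) T (j' \<circ> \<Phi>)"
      using proper homeomorphic_imp_proper_map[OF h'] by (rule proper_map_compose)
    have "j' ` j ` topspace T = topspace T"
      using j' by (force simp: homeomorphic_maps_def image_image)
    then show "(j' \<circ> \<Phi>) ` topspace (subtopology B S) = topspace T"
      using im S(2) by (simp only: topspace_subtopology_subset image_comp[symmetric])
  qed
  moreover have "(j' \<circ> \<Phi>) (i x) = e x" if "x \<in> topspace X" for x
    using \<Phi>X[OF that] j' eT[OF that] by (simp add: homeomorphic_maps_def)
  ultimately show ?thesis
    using that S unfolding resolution_def by blast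
qed

text \<open>The identity of the dense copy of \<open>X\<close> is itself a resolution, so \<open>\<psi>\<close>, being an extension of it
  over \<open>\<psi>\<inverse>(e(X))\<close>, cannot map further points into \<open>e(X)\<close>.\<close>
lemma resolution_remainder:
  assumes res: "resolution X B i T e S \<psi>" and e: "embedding_map X T e"
    and p: "p \<in> S" "\<psi> p \<in> e ` topspace X"
  shows "p \<in> i ` topspace X"
proof -
  have S: "i ` topspace X \<subseteq> S" "S \<subseteq> topspace B" and \<psi>X: "\<And>x. x \<in> topspace X \<Longrightarrow> \<psi> (i x) = e x"
    and perf: "perfect_map (subtopology B S) T \<psi>"
    using res by (auto simp: resolution_def)
  obtain e' where e': "homeomorphic_maps X (subtopology T (e ` topspace X)) e e'"
    using e unfolding embedding_map_def homeomorphic_map_maps by blast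
  define S' where "S' = {q \<in> S. \<psi> q \<in> e ` topspace X}"
  have "homeomorphic_map (subtopology B (i ` topspace X)) (subtopology B (i ` topspace X)) id"
    by simp
  then have "resolution X B i (subtopology B (i ` topspace X)) i (i ` topspace X) id"
    unfolding resolution_def perfect_map_def
    using image_subset homeomorphic_imp_proper_map homeomorphic_imp_continuous_map by auto
  moreover have "Hausdorff_space (subtopology B (i ` topspace X))"
    using Hausdorff by (rule Hausdorff_space_subtopology)
  moreover have "i ` topspace X \<subseteq> S'" "S' \<subseteq> topspace B"
    using S \<psi>X by (auto simp: S'_def)
  moreover have "continuous_map (subtopology B S') (subtopology B (i ` topspace X)) (i \<circ> (e' \<circ> \<psi>))"
  proof (intro continuous_map_compose)
    have "continuous_map (subtopology (subtopology B S) S') T \<psi>"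
      using perfect_imp_continuous_map[OF perf] by (rule continuous_map_from_subtopology)
    moreover have "S \<inter> S' = S'"
      by (auto simp: S'_def)
    ultimately show "continuous_map (subtopology B S') (subtopology T (e ` topspace X)) \<psi>"
      by (auto simp: continuous_map_in_subtopology subtopology_subtopology S'_def)
    show "continuous_map (subtopology T (e ` topspace X)) X e'"
      using e' by (simp add: homeomorphic_maps_def)
    show "continuous_map X (subtopology B (i ` topspace X)) i"
      using homeo by (rule homeomorphic_imp_continuous_map)
  qed
  moreover have "(i \<circ> (e' \<circ> \<psi>)) (i x) = i x" if "x \<in> topspace X" for x
    using \<psi>X[OF that] e' that by (simp add: homeomorphic_maps_def)
  ultimately have "S' \<subseteq> i ` topspace X"
    by (rule extension_eq_resolution(1))
  then show ?thesis
    using p by (auto simp: S'_def)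
qed

text \<open>Over a point \<open>p\<close> of the Hewitt set all real functions on \<open>X\<close>
  extend, in particular the coordinates of \<open>T\<close> as a closed subspace of a power of the
  reals. So \<open>e\<close> extends over \<open>p\<close>, and maximality of the resolution puts
  \<open>p\<close> into \<open>S\<close>.\<close>

lemma hewitt_set_subset_resolution:
  fixes T :: "'b topology"
  assumes res: "resolution X B i T e S \<psi>" and T: "Hausdorff_space T" "realcompact_space T"
    and ce: "continuous_map X T e"
  shows "hewitt_set X B i \<subseteq> S"
proof
  fix p assume p: "p \<in> hewitt_set X B i"
  then have pB: "p \<in> topspace B"
    by (simp add: hewitt_set_def)
  obtain I :: "('b \<Rightarrow> real) set" and C where C: "closedin (powertop_real I) C" "T homeomorphic_space subtopology (powertop_real I) C"
    using T(2) unfolding realcompact_space_def by blast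
  obtain h h' where h: "homeomorphic_maps T (subtopology (powertop_real I) C) h h'"
    using C(2) unfolding homeomorphic_space_def by blast
  have hh': "h' (h t) = t" if "t \<in> topspace T" for t
    using h that by (simp add: homeomorphic_maps_def)
  have ch: "continuous_map T (powertop_real I) h" and hC: "h ` topspace T \<subseteq> C"
    using h by (auto simp: homeomorphic_maps_def continuous_map_in_subtopology)
  define S' where "S' = insert p (i ` topspace X)"
  have S': "i ` topspace X \<subseteq> S'" "S' \<subseteq> topspace B"
    using pB image_subset by (auto simp: S'_def)
  have eT: "e x \<in> topspace T" if "x \<in> topspace X" for x
    using that ce by (auto simp: continuous_map_def Pi_iff)
  have "\<exists>g. continuous_map (subtopology B S') euclideanreal g \<and> (\<forall>x\<in>topspace X. g (i x) = h (e x) k)"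
    if k: "k \<in> I" for k
  proof -
    have "continuous_map X euclideanreal (\<lambda>x. h (e x) k)"
      using continuous_map_compose[OF ce ch] k by (simp add: continuous_map_componentwise o_def)
    then show ?thesis
      using p unfolding hewitt_set_def S'_def by blast
  qed
  then obtain g where g: "\<And>k. k \<in> I \<Longrightarrow> continuous_map (subtopology B S') euclideanreal (g k)"
    "\<And>k x. k \<in> I \<Longrightarrow> x \<in> topspace X \<Longrightarrow> g k (i x) = h (e x) k"
    by metis
  define \<Phi> where "\<Phi> = (\<lambda>q. \<lambda>k\<in>I. g k q)"
  have c\<Phi>: "continuous_map (subtopology B S') (powertop_real I) \<Phi>"
    unfolding \<Phi>_def using g(1) by (auto simp: continuous_map_componentwise)
  have \<Phi>X: "\<Phi> (i x) = h (e x)" if "x \<in> topspace X" for x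
  proof
    fix k
    have "h (e x) \<in> topspace (powertop_real I)"
      using ch eT[OF that] by (auto simp: continuous_map_def Pi_iff)
    then show "\<Phi> (i x) k = h (e x) k"
      unfolding \<Phi>_def using g(2)[OF _ that] by (cases "k \<in> I") (simp_all add: PiE_iff extensional_def)
  qed
  \<comment> \<open>By density of \<open>X\<close> the value at \<open>p\<close> is a limit of
    points of \<open>C\<close>; closedness of \<open>C\<close> keeps it in the copy of
    \<open>T\<close>.\<close>
  have "\<Phi> ` S' \<subseteq> powertop_real I closure_of (\<Phi> ` i ` topspace X)"
    using continuous_map_image_closure_subset[OF c\<Phi>, of "i ` topspace X"] dense_subtopology[OF S'] by simp
  also have "\<dots> \<subseteq> C"
    by (rule closure_of_minimal[OF _ C(1)]) (use \<Phi>X hC eT in force)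
  finally have "continuous_map (subtopology B S') (subtopology (powertop_real I) C) \<Phi>"
    using c\<Phi> S'(2) by (auto simp: continuous_map_in_subtopology)
  moreover have "continuous_map (subtopology (powertop_real I) C) T h'"
    using h by (simp add: homeomorphic_maps_def)
  ultimately have "continuous_map (subtopology B S') T (h' \<circ> \<Phi>)"
    by (rule continuous_map_compose)
  moreover have "(h' \<circ> \<Phi>) (i x) = e x" if "x \<in> topspace X" for x
    using \<Phi>X[OF that] hh' eT[OF that] by simp
  ultimately have "S' \<subseteq> S"
    by (rule extension_eq_resolution(1)[OF res T(1) S'])
  then show "p \<in> S"
    by (simp add: S'_def)
qed

text \<open>A comparison map composed with \<open>\<psi>'\<close> extends \<open>e\<close>, so it is
  the restriction of \<open>\<psi>\<close> to \<open>S'\<close>. Conversely \<open>\<psi>'\<close>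
  is a quotient map, and \<open>\<psi>\<close> factors through it once it is constant on its
  fibres.\<close>

lemma ext_le_iff_resolution:
  assumes res: "resolution X B i T e S \<psi>" and T: "Hausdorff_space T"
    and res': "resolution X B i T' e' S' \<psi>'"
  shows "ext_le X (T, e) (T', e') \<longleftrightarrow>
    S' \<subseteq> S \<and> (\<forall>p\<in>S'. \<forall>q\<in>S'. \<psi>' p = \<psi>' q \<longrightarrow> \<psi> p = \<psi> q)"
proof
  have S: "i ` topspace X \<subseteq> S" "S \<subseteq> topspace B" and \<psi>X: "\<And>x. x \<in> topspace X \<Longrightarrow> \<psi> (i x) = e x"
    and perf: "perfect_map (subtopology B S) T \<psi>"
    using res by (auto simp: resolution_def)
  have S': "i ` topspace X \<subseteq> S'" "S' \<subseteq> topspace B" and \<psi>X': "\<And>x. x \<in> topspace X \<Longrightarrow> \<psi>' (i x) = e' x"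
    and perf': "perfect_map (subtopology B S') T' \<psi>'"
    using res' by (auto simp: resolution_def)
  {
    assume "ext_le X (T, e) (T', e')"
    then obtain f where f: "continuous_map T' T f" "\<And>x. x \<in> topspace X \<Longrightarrow> f (e' x) = e x"
      by (auto simp: ext_le_def)
    have "continuous_map (subtopology B S') T (f \<circ> \<psi>')"
      using perfect_imp_continuous_map[OF perf'] f(1) by (rule continuous_map_compose)
    moreover have "(f \<circ> \<psi>') (i x) = e x" if "x \<in> topspace X" for x
      using f(2) \<psi>X' that by simp
    ultimately have "S' \<subseteq> S \<and> (\<forall>p\<in>S'. (f \<circ> \<psi>') p = \<psi> p)"
      using extension_eq_resolution[OF res T S', of "f \<circ> \<psi>'"] by blast
    then show "S' \<subseteq> S \<and> (\<forall>p\<in>S'. \<forall>q\<in>S'. \<psi>' p = \<psi>' q \<longrightarrow> \<psi> p = \<psi> q)"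
      by (metis comp_apply)
  next
    assume R: "S' \<subseteq> S \<and> (\<forall>p\<in>S'. \<forall>q\<in>S'. \<psi>' p = \<psi>' q \<longrightarrow> \<psi> p = \<psi> q)"
    have quot: "quotient_map (subtopology B S') T' \<psi>'"
      using perf' by (rule perfect_imp_quotient_map)
    have "continuous_map (subtopology (subtopology B S) S') T \<psi>"
      using perfect_imp_continuous_map[OF perf] by (rule continuous_map_from_subtopology)
    then have "continuous_map (subtopology B S') T \<psi>"
      using R by (simp add: subtopology_subtopology inf.absorb2)
    then obtain f where f: "continuous_map T' T f"
      "\<And>p. p \<in> topspace (subtopology B S') \<Longrightarrow> f (\<psi>' p) = \<psi> p"
      using quotient_map_lift_exists[OF quot] R by (metis Int_iff topspace_subtopology)
    have "f (e' x) = e x" if "x \<in> topspace X" for x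
    proof -
      have "f (\<psi>' (i x)) = \<psi> (i x)"
        by (rule f(2)) (use that S' in auto)
      then show ?thesis
        using \<psi>X \<psi>X' that by simp
    qed
    with f(1) show "ext_le X (T, e) (T', e')"
      by (auto simp: ext_le_def)
  }
qed

section \<open>Realizing prescribed relations by realcompact extensions\<close>

text \<open>Points of \<open>\<beta>X\<close> are named by the traces on \<open>X\<close> of their neighbourhoods; this places
  quotients of \<open>\<beta>X\<close> into the carrier type prescribed for members of \<open>\<R>(X)\<close>.\<close>
definition trace_code :: "'c \<Rightarrow> 'a set set" where
  "trace_code p = {{x \<in> topspace X. i x \<in> W} | W. openin B W \<and> p \<in> W}"

text \<open>With equal codes, the trace of a neighbourhood of \<open>p\<close> is also the trace of
  a neighbourhood of \<open>q\<close>; density then yields a point of \<open>X\<close> in two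
  disjoint open sets.\<close>

lemma inj_on_trace_code: "inj_on trace_code (topspace B)"
proof (rule inj_onI, rule ccontr)
  fix p q assume pq: "p \<in> topspace B" "q \<in> topspace B" "trace_code p = trace_code q" "p \<noteq> q"
  obtain U V where UV: "openin B U" "openin B V" "p \<in> U" "q \<in> V" "disjnt U V"
    using Hausdorff pq unfolding Hausdorff_space_def by metis
  have "{x \<in> topspace X. i x \<in> U} \<in> trace_code q"
    using UV pq(3) unfolding trace_code_def by blast
  then obtain W where W: "openin B W" "q \<in> W" "{x \<in> topspace X. i x \<in> U} = {x \<in> topspace X. i x \<in> W}"
    unfolding trace_code_def by blast
  have "q \<in> B closure_of (i ` topspace X)"
    using dense pq(2) by simp
  moreover have "openin B (V \<inter> W)" "q \<in> V \<inter> W"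
    using UV W by auto
  ultimately obtain x where x: "x \<in> topspace X" "i x \<in> V" "i x \<in> W"
    unfolding in_closure_of by blast
  then have "i x \<in> U"
    using W(3) by blast
  then show False
    using x UV(5) by (auto simp: disjnt_iff)
qed

text \<open>Since \<open>p\<close> lies off the Hewitt set, some function vanishes at
  \<open>p\<close> and nowhere on \<open>X\<close>; a Urysohn function adjusts it on
  \<open>D\<close> without creating zeros on \<open>X\<close>.\<close>

lemma zero_function_off_hewitt_set:
  assumes D: "closedin B D" "hewitt_set X B i - i ` topspace X \<subseteq> D"
    and p: "p \<in> topspace B" "p \<notin> i ` topspace X" "p \<notin> D"
  obtains k where "continuous_map B euclideanreal k" "k p = 0" "\<And>q. q \<in> D \<Longrightarrow> k q = 1"
    "\<And>x. x \<in> topspace X \<Longrightarrow> k (i x) \<noteq> 0"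
proof -
  have "p \<notin> hewitt_set X B i"
    using D p by blast
  then obtain k where k: "continuous_map B euclideanreal k" "k p = 0" "\<And>x. x \<in> topspace X \<Longrightarrow> k (i x) \<noteq> 0"
    using not_in_hewitt_set_imp_zero[OF stone_cech p(1)] by blast
  have "closedin B {p}"
    using Hausdorff p(1) by (simp add: closedin_Hausdorff_singleton)
  moreover have "disjnt {p} D"
    using p(3) by simp
  ultimately obtain w where w: "continuous_map B (top_of_set {0..1::real}) w" "w ` {p} \<subseteq> {0}" "w ` D \<subseteq> {1}"
    using Urysohn_lemma[OF normal _ D(1), of "{p}" 0 1] by auto
  \<comment> \<open>Truncation at 1 makes the maximum exactly 1 on \<open>D\<close>, where
    \<open>w\<close> is 1. Both terms vanish at \<open>p\<close>, and the first is positive on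
    \<open>X\<close>.\<close>
  define k' where "k' = (\<lambda>q. max (min \<bar>k q\<bar> 1) (w q))"
  have wB: "continuous_map B euclideanreal w" "\<And>q. q \<in> topspace B \<Longrightarrow> 0 \<le> w q"
    using w(1) by (auto simp: continuous_map_in_subtopology)
  have "continuous_map B euclideanreal k'"
    unfolding k'_def using k(1) wB(1)
    by (intro continuous_map_real_max continuous_map_real_min continuous_map_real_abs) auto
  moreover have "k' p = 0"
    using k(2) w(2) by (simp add: k'_def)
  moreover have "k' q = 1" if "q \<in> D" for q
  proof -
    have "w q = 1"
      using w(3) that by blast
    then show ?thesis
      by (simp add: k'_def)
  qed
  moreover have "k' (i x) \<noteq> 0" if "x \<in> topspace X" for x
  proof -
    have "0 < min \<bar>k (i x)\<bar> 1"
      using k(3)[OF that] by simp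
    then have "0 < k' (i x)"
      unfolding k'_def by (meson less_max_iff_disj)
    then show ?thesis
      by simp
  qed
  ultimately show ?thesis
    using that by blast
qed

text \<open>The quotient is formed on the whole of \<open>\<beta>X\<close>, where it is compact Hausdorff, and then restricted.
  Realcompactness survives because the functions witnessing that a point lies outside \<open>\<upsilon>X\<close> can be
  chosen constant on \<open>D\<close>, hence compatible with the identification of \<open>a\<close> and \<open>b\<close>.\<close>
lemma realize_identification:
  assumes D: "closedin B D" "hewitt_set X B i - i ` topspace X \<subseteq> D" "D \<inter> i ` topspace X = {}"
    and ab: "a \<in> D" "b \<in> D"
  obtains T :: "'a set set topology" and e \<psi>
  where "(T, e) \<in> RX X" "resolution X B i T e (i ` topspace X \<union> D) \<psi>"
    "\<And>p q. p \<in> i ` topspace X \<union> D \<Longrightarrow> q \<in> i ` topspace X \<union> D \<Longrightarrow>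
       \<psi> p = \<psi> q \<longleftrightarrow> p = q \<or> p \<in> {a, b} \<and> q \<in> {a, b}"
proof -
  define S where "S = i ` topspace X \<union> D"
  have DB: "D \<subseteq> topspace B"
    using D(1) by (rule closedin_subset)
  then have SB: "S \<subseteq> topspace B"
    using image_subset by (auto simp: S_def)
  have abB: "a \<in> topspace B" "b \<in> topspace B"
    using ab DB by auto
  \<comment> \<open>The point \<open>b\<close> receives the code of \<open>a\<close>; for
    \<open>a = b\<close> nothing is glued.\<close>
  define f where "f = (\<lambda>p. trace_code (if p = b then a else p))"
  have f_eq: "f p = f q \<longleftrightarrow> p = q \<or> p \<in> {a, b} \<and> q \<in> {a, b}"
    if "p \<in> topspace B" "q \<in> topspace B" for p q
    unfolding f_def using inj_on_eq_iff[OF inj_on_trace_code] that abB by auto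
  obtain Q where quot: "quotient_map B Q f"
    using quotient_topology_exists by blast
  have cf: "continuous_map B Q f" and fim: "f ` topspace B = topspace Q"
    using quot by (simp_all add: quotient_imp_continuous_map quotient_imp_surjective_map)
  have "closed_map B Q f"
    unfolding closed_map_def
  proof (intro allI impI)
    fix C assume C: "closedin B C"
    then have CB: "C \<subseteq> topspace B"
      by (rule closedin_subset)
    have "closedin B {a, b}"
      using abB Hausdorff by (simp add: closedin_Hausdorff_finite)
    then have "closedin B (C \<union> {a, b})"
      using C by (intro closedin_Un)
    \<comment> \<open>Saturating a closed set adds at most the two points \<open>a\<close> and
      \<open>b\<close>, so \<open>f\<close> is a closed map and the quotient is Hausdorff.\<close>
    moreover have "{p \<in> topspace B. f p \<in> f ` C} = (if C \<inter> {a, b} = {} then C else C \<union> {a, b})"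
      using f_eq CB abB by (auto simp: image_iff subset_iff)
    ultimately have "closedin B {p \<in> topspace B. f p \<in> f ` C}"
      using C by simp
    moreover have "f ` C \<subseteq> topspace Q"
      using CB fim by (metis image_mono)
    ultimately show "closedin Q (f ` C)"
      using quot by (simp add: quotient_map_closedin)
  qed
  then have HQ: "Hausdorff_space Q"
    using normal_Hausdorff_space_closed_continuous_map_image[OF normal Hausdorff _ cf fim] by blast
  have compQ: "compact_space Q"
    using image_compactin[OF _ cf, of "topspace B"] compact fim by (simp add: compact_space_def)
  have normQ: "normal_space Q"
    using compQ HQ compact_Hausdorff_or_regular_imp_normal_space by blast
  have properf: "proper_map B Q f"
    using compact HQ cf by (intro continuous_imp_proper_map Hausdorff_imp_kc_space) auto
  define T where "T = subtopology Q (f ` S)"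
  have fSQ: "f ` S \<subseteq> topspace Q"
    using fim SB by blast
  then have topT: "topspace T = f ` S"
    by (auto simp: T_def)
  have saturated: "{p \<in> topspace B. f p \<in> f ` Z} = Z"
    if Z: "Z \<subseteq> topspace B" "a \<in> Z \<longleftrightarrow> b \<in> Z" for Z
  proof (intro equalityI subsetI)
    fix p assume "p \<in> {p \<in> topspace B. f p \<in> f ` Z}"
    then obtain z where z: "p \<in> topspace B" "z \<in> Z" "f p = f z"
      by blast
    then have "p = z \<or> p \<in> {a, b} \<and> z \<in> {a, b}"
      using f_eq Z(1) by blast
    then show "p \<in> Z"
      using z(2) Z(2) by blast
  qed (use Z in auto)
  have satS: "{p \<in> topspace B. f p \<in> f ` S} = S"
    using SB ab by (intro saturated) (auto simp: S_def)
  have satX: "{p \<in> topspace B. f p \<in> f ` i ` topspace X} = i ` topspace X"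
    using image_subset ab D(3) by (intro saturated) auto
  have "perfect_map (subtopology B S) T f"
    unfolding perfect_map_def
  proof (intro conjI)
    show "continuous_map (subtopology B S) T f"
      unfolding T_def using cf by (auto simp: continuous_map_in_subtopology continuous_map_from_subtopology)
    show "proper_map (subtopology B S) T f"
      unfolding T_def using properf satS by (rule proper_map_restriction)
    show "f ` topspace (subtopology B S) = topspace T"
      using SB topT by (simp add: inf.absorb2)
  qed
  then have res: "resolution X B i T (f \<circ> i) S f"
    using SB by (auto simp: resolution_def S_def)
  have "homeomorphic_map (subtopology B (i ` topspace X)) (subtopology Q (f ` i ` topspace X)) f"
  proof (rule bijective_closed_imp_homeomorphic_map)
    show "continuous_map (subtopology B (i ` topspace X)) (subtopology Q (f ` i ` topspace X)) f"
      using cf by (auto simp: continuous_map_in_subtopology continuous_map_from_subtopology)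
    show "closed_map (subtopology B (i ` topspace X)) (subtopology Q (f ` i ` topspace X)) f"
      using \<open>closed_map B Q f\<close> satX by (rule closed_map_restriction)
    show "f ` topspace (subtopology B (i ` topspace X)) = topspace (subtopology Q (f ` i ` topspace X))"
      using image_subset fim by auto
    show "inj_on f (topspace (subtopology B (i ` topspace X)))"
    proof (rule inj_onI)
      fix p q assume "p \<in> topspace (subtopology B (i ` topspace X))"
        "q \<in> topspace (subtopology B (i ` topspace X))" "f p = f q"
      then have "p \<in> topspace B" "q \<in> topspace B" "p \<notin> {a, b}" "f p = f q"
        using ab D(3) by auto
      then show "p = q"
        using f_eq by blast
    qed
  qed
  then have "homeomorphic_map X (subtopology Q (f ` i ` topspace X)) (f \<circ> i)"
    by (rule homeomorphic_map_compose[OF homeo])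
  moreover have img: "(f \<circ> i) ` topspace X = f ` i ` topspace X"
    by (simp add: image_image)
  moreover have fi: "f ` i ` topspace X \<subseteq> f ` S"
    by (auto simp: S_def)
  ultimately have "embedding_map X T (f \<circ> i)"
    unfolding embedding_map_def T_def img subtopology_subtopology by (simp add: inf.absorb2)
  moreover have "T closure_of ((f \<circ> i) ` topspace X) = topspace T"
  proof -
    have "topspace Q \<subseteq> Q closure_of (f ` i ` topspace X)"
      using continuous_map_image_closure_subset[OF cf, of "i ` topspace X"] dense fim by simp
    then have "f ` S \<subseteq> Q closure_of (f ` i ` topspace X)"
      using fSQ by blast
    then show ?thesis
      using fi unfolding topT img unfolding T_def by (simp add: closure_of_subtopology inf.absorb1 inf.absorb2)
  qed
  ultimately have ext: "is_extension X T (f \<circ> i)"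
    by (simp add: is_extension_def)
  have HT: "Hausdorff_space T"
    unfolding T_def using HQ by (rule Hausdorff_space_subtopology)
  have "completely_regular_space Q"
    using normQ HQ normal_imp_completely_regular_space by blast
  then have crT: "completely_regular_space T"
    unfolding T_def by (rule completely_regular_space_subtopology)
  have rem: "topspace T - (f \<circ> i) ` topspace X = f ` D"
  proof -
    have "f d \<notin> f ` i ` topspace X" if "d \<in> D" for d
      using satX that DB D(3) by blast
    then show ?thesis
      unfolding topT img S_def by blast
  qed
  have "compactin B D"
    using compact D(1) by (rule closedin_compact_space)
  then have "compactin Q (f ` D)"
    using cf by (rule image_compactin)
  then have compT: "compactin T (topspace T - (f \<circ> i) ` topspace X)"
    unfolding rem unfolding T_def by (auto simp: compactin_subtopology S_def)
  have "realcompact_space T"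
  proof (rule realcompact_spaceI[OF compQ HQ, where e = id])
    show "embedding_map T Q id"
      using fSQ by (simp add: embedding_map_def T_def inf.absorb2)
    fix u assume u: "u \<in> topspace Q - id ` topspace T"
    then obtain p where p: "p \<in> topspace B" "u = f p"
      using fim by blast
    have "p \<notin> S"
      using u p topT by auto
    then obtain k where k: "continuous_map B euclideanreal k" "k p = 0" "\<And>q. q \<in> D \<Longrightarrow> k q = 1"
      "\<And>x. x \<in> topspace X \<Longrightarrow> k (i x) \<noteq> 0"
      using zero_function_off_hewitt_set[OF D(1,2) p(1)] unfolding S_def by blast
    have "k x = k y" if "x \<in> topspace B" "y \<in> topspace B" "f x = f y" for x y
      using f_eq[OF that(1,2)] that(3) k(3) ab by auto
    then obtain g where g: "continuous_map Q euclideanreal g" "\<And>x. x \<in> topspace B \<Longrightarrow> g (f x) = k x"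
      using quotient_map_lift_exists[OF quot k(1)] by metis
    have "g t \<noteq> 0" if t: "t \<in> topspace T" for t
    proof -
      obtain s where s: "s \<in> S" "t = f s"
        using t topT by blast
      then have "g t = k s"
        using g(2) SB by blast
      moreover have "k s \<noteq> 0"
        using s(1) k(3,4) by (auto simp: S_def)
      ultimately show ?thesis
        by simp
    qed
    then show "\<exists>k. continuous_map Q euclideanreal k \<and> k u = 0 \<and> (\<forall>t\<in>topspace T. k (id t) \<noteq> 0)"
      using g p k(2) by (intro exI[of _ g]) auto
  qed
  then have "(T, f \<circ> i) \<in> RX X"
    using ext HT crT compT by (simp add: RX_def)
  moreover have "f p = f q \<longleftrightarrow> p = q \<or> p \<in> {a, b} \<and> q \<in> {a, b}" if "p \<in> S" "q \<in> S" for p q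
    using that SB by (intro f_eq) auto
  ultimately show ?thesis
    using res unfolding S_def by (intro that[of T "f \<circ> i" f])
qed

section \<open>Realcompact extensions as an order of relations\<close>

lemma remainder_closedin:
  assumes "locally_compact_space X"
  shows "closedin B (topspace B - i ` topspace X)"
proof -
  have "locally_compact_space (subtopology B (i ` topspace X))"
    using assms homeo homeomorphic_locally_compact_space homeomorphic_map_imp_homeomorphic_space by blast
  then have "openin B (i ` topspace X)"
    using dense_locally_compact_openin_Hausdorff_space[OF Hausdorff image_subset dense] by blast
  then show ?thesis
    by blast
qed

text \<open>Otherwise every point of the remainder is a zero of a function without zeros on
  \<open>X\<close>, and \<open>realcompact_spaceI\<close> applies to \<open>B\<close>
  itself.\<close>

lemma hewitt_set_remainder_nonempty:
  assumes "\<not> realcompact_space X"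
  shows "hewitt_set X B i - i ` topspace X \<noteq> {}"
proof
  assume empty: "hewitt_set X B i - i ` topspace X = {}"
  have "\<exists>k. continuous_map B euclideanreal k \<and> k p = 0 \<and> (\<forall>x\<in>topspace X. k (i x) \<noteq> 0)"
    if p: "p \<in> topspace B - i ` topspace X" for p
  proof -
    have "p \<in> topspace B" "p \<notin> hewitt_set X B i"
      using p empty by auto
    from not_in_hewitt_set_imp_zero[OF stone_cech this] show ?thesis
      by metis
  qed
  then have "realcompact_space X"
    by (rule realcompact_spaceI[OF compact Hausdorff emb])
  then show False
    using assms by blast
qed

text \<open>\<open>R E\<close> is the kernel of the resolution of \<open>E\<close> off
  \<open>X\<close>. Compactness of the remainder of \<open>E\<close> makes its domain closed,
  realcompactness makes the domain contain \<open>K\<close>, and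
  \<open>realize_identification\<close> provides \<open>realize\<close>.\<close>

lemma relation_order_RX:
  assumes lc: "locally_compact_space X" and nrc: "\<not> realcompact_space X"
  obtains R where "relation_order (RX X) (ext_le X) B (topspace B - i ` topspace X)
    (B closure_of (hewitt_set X B i - i ` topspace X)) R"
proof -
  define N where "N = topspace B - i ` topspace X"
  define K where "K = B closure_of (hewitt_set X B i - i ` topspace X)"
  have N: "closedin B N"
    unfolding N_def using lc by (rule remainder_closedin)
  have HN: "hewitt_set X B i - i ` topspace X \<subseteq> N"
    by (auto simp: N_def hewitt_set_def)
  have HK: "hewitt_set X B i - i ` topspace X \<subseteq> K"
    unfolding K_def using HN by (intro closure_of_subset) (auto simp: N_def)
  have K: "closedin B K" "K \<subseteq> N" "K \<noteq> {}"
  proof -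
    show "K \<subseteq> N"
      unfolding K_def using HN N by (rule closure_of_minimal)
    show "K \<noteq> {}"
      using HK hewitt_set_remainder_nonempty[OF nrc] by blast
  qed (simp add: K_def)
  have RXD: "Hausdorff_space T" "completely_regular_space T" "realcompact_space T" "is_extension X T e"
    "embedding_map X T e" "continuous_map X T e" "compactin T (topspace T - e ` topspace X)"
    if "(T, e) \<in> RX X" for T e
  proof -
    show "Hausdorff_space T" "completely_regular_space T" "realcompact_space T" "is_extension X T e"
      "compactin T (topspace T - e ` topspace X)"
      using that by (auto simp: RX_def)
    then show em: "embedding_map X T e"
      by (simp add: is_extension_def)
    then show "continuous_map X T e"
      using embedding_map_def continuous_map_in_subtopology homeomorphic_imp_continuous_map by metis
  qed
  have "\<forall>E. \<exists>S \<psi>. E \<in> RX X \<longrightarrow> resolution X B i (fst E) (snd E) S \<psi>"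
    using RXD resolution_exists by (metis prod.collapse)
  then obtain S \<psi> where res: "\<And>E. E \<in> RX X \<Longrightarrow> resolution X B i (fst E) (snd E) (S E) (\<psi> E)"
    by metis
  define R where "R = (\<lambda>E. {(p, q). p \<in> S E - i ` topspace X \<and> q \<in> S E - i ` topspace X \<and> \<psi> E p = \<psi> E q})"
  have SE: "i ` topspace X \<subseteq> S E" "S E \<subseteq> topspace B" "\<And>x. x \<in> topspace X \<Longrightarrow> \<psi> E (i x) = snd E x"
    "proper_map (subtopology B (S E)) (fst E) (\<psi> E)" "\<psi> E ` S E = topspace (fst E)"
    if "E \<in> RX X" for E
    using res[OF that] by (auto simp: resolution_def perfect_map_def inf.absorb2)
  have Dom: "Domain (R E) = S E - i ` topspace X" for E
    by (auto simp: R_def)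
  have "relation_order (RX X) (ext_le X) B N K R"
  proof
    show "t1_space B"
      using Hausdorff by (rule Hausdorff_imp_t1_space)
    show "closedin B N" "closedin B K" "K \<subseteq> N" "K \<noteq> {}"
      using N K by auto
    show "ext_le X E E' \<longleftrightarrow> R E' \<subseteq> R E" if E: "E \<in> RX X" "E' \<in> RX X" for E E'
    proof -
      have em: "embedding_map X (fst E') (snd E')"
        using RXD(5)[of "fst E'" "snd E'"] E(2) by simp
      then have inj: "inj_on (snd E') (topspace X)"
        by (simp add: embedding_map_def homeomorphic_imp_injective_map)
      have "ext_le X E E' \<longleftrightarrow>
          S E' \<subseteq> S E \<and> (\<forall>p\<in>S E'. \<forall>q\<in>S E'. \<psi> E' p = \<psi> E' q \<longrightarrow> \<psi> E p = \<psi> E q)"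
        using ext_le_iff_resolution[OF res[OF E(1)] _ res[OF E(2)]] RXD(1)[of "fst E" "snd E"] E(1) by simp
      also have "\<dots> \<longleftrightarrow> R E' \<subseteq> R E"
      proof
        assume "S E' \<subseteq> S E \<and> (\<forall>p\<in>S E'. \<forall>q\<in>S E'. \<psi> E' p = \<psi> E' q \<longrightarrow> \<psi> E p = \<psi> E q)"
        then show "R E' \<subseteq> R E"
          by (auto simp: R_def)
      next
        assume sub: "R E' \<subseteq> R E"
        then have "S E' - i ` topspace X \<subseteq> S E - i ` topspace X"
          unfolding Dom[symmetric] by (rule Domain_mono)
        then have "S E' \<subseteq> S E"
          using SE(1)[OF E(1)] by blast
        moreover have "\<psi> E p = \<psi> E q" if pq: "p \<in> S E'" "q \<in> S E'" "\<psi> E' p = \<psi> E' q" for p q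
        proof (cases "p \<in> i ` topspace X \<or> q \<in> i ` topspace X")
          \<comment> \<open>If one of the points comes from \<open>X\<close>, so does the other by
            \<open>resolution_remainder\<close>, and injectivity of the embedding gives
            \<open>p = q\<close>.\<close>
          case True
          have "\<psi> E' p \<in> snd E' ` topspace X"
            using True SE(3)[OF E(2)] pq(3) by auto
          then have "p \<in> i ` topspace X" "q \<in> i ` topspace X"
            using resolution_remainder[OF res[OF E(2)] em] pq by auto
          then have "p = q"
            using SE(3)[OF E(2)] pq(3) by (auto simp: inj_on_eq_iff[OF inj])
          then show ?thesis
            by simp
        next
          case False
          then have "(p, q) \<in> R E'"
            using pq by (simp add: R_def)
          then have "(p, q) \<in> R E"
            using sub by blast
          then show ?thesis
            by (simp add: R_def)
        qed
        ultimately show "S E' \<subseteq> S E \<and> (\<forall>p\<in>S E'. \<forall>q\<in>S E'. \<psi> E' p = \<psi> E' q \<longrightarrow> \<psi> E p = \<psi> E q)"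
          by blast
      qed
      finally show ?thesis .
    qed
    fix E assume E: "E \<in> RX X"
    show "R E \<subseteq> N \<times> N"
      using SE(2)[OF E] by (auto simp: R_def N_def)
    show "sym (R E)"
      by (auto simp: R_def sym_def)
    show "trans (R E)"
      by (auto simp: R_def trans_def)
    have E': "(fst E, snd E) \<in> RX X"
      using E by simp
    \<comment> \<open>The domain is the full preimage of the compact remainder of \<open>E\<close>
      under a proper map, hence compact.\<close>
    have "{p \<in> topspace (subtopology B (S E)). \<psi> E p \<in> topspace (fst E) - snd E ` topspace X} = Domain (R E)"
      using SE(2,3,5)[OF E] resolution_remainder[OF res[OF E] RXD(5)[OF E']] unfolding Dom
      by auto
    then have "compactin (subtopology B (S E)) (Domain (R E))"
      using compactin_proper_map_preimage[OF SE(4)[OF E] RXD(7)[OF E']] by simp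
    then have "compactin B (Domain (R E))"
      by (simp add: compactin_subtopology)
    then show clo: "closedin B (Domain (R E))"
      using Hausdorff compactin_imp_closedin by blast
    have "hewitt_set X B i - i ` topspace X \<subseteq> Domain (R E)"
      using hewitt_set_subset_resolution[OF res[OF E] RXD(1,3,6)[OF E' ]] E unfolding Dom by auto
    then have "K \<subseteq> Domain (R E)"
      unfolding K_def using clo by (rule closure_of_minimal)
    then show "Id_on K \<subseteq> R E"
      unfolding Dom by (auto simp: R_def)
  next
    fix D a b assume D: "closedin B D" "K \<subseteq> D" "D \<subseteq> N" "a \<in> D" "b \<in> D"
    have HD: "hewitt_set X B i - i ` topspace X \<subseteq> D"
      using HK D(2) by (rule order_trans)
    have disj: "D \<inter> i ` topspace X = {}"
      using D(3) by (auto simp: N_def)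
    obtain T :: "'a set set topology" and e \<phi>
      where T: "(T, e) \<in> RX X" "resolution X B i T e (i ` topspace X \<union> D) \<phi>"
        and eq: "\<And>p q. p \<in> i ` topspace X \<union> D \<Longrightarrow> q \<in> i ` topspace X \<union> D \<Longrightarrow>
       \<phi> p = \<phi> q \<longleftrightarrow> p = q \<or> p \<in> {a, b} \<and> q \<in> {a, b}"
      by (rule realize_identification[OF D(1) HD disj D(4,5)]) (rule that)
    \<comment> \<open>\<open>S\<close> and \<open>\<psi>\<close> were arbitrary choices for each
      member; uniqueness identifies the choice at \<open>(T, e)\<close> with the constructed
      resolution.\<close>
    have res': "resolution X B i T e (S (T, e)) (\<psi> (T, e))"
      using res[OF T(1)] by simp
    have S: "S (T, e) = i ` topspace X \<union> D" "\<And>p. p \<in> S (T, e) \<Longrightarrow> \<psi> (T, e) p = \<phi> p"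
      using resolution_unique[OF res' T(2) RXD(1)[OF T(1)]] by auto
    have SD: "S (T, e) - i ` topspace X = D"
      using S(1) disj by blast
    have "(p, q) \<in> R (T, e) \<longleftrightarrow> (p, q) \<in> Id_on D \<union> {(a, b), (b, a)}" for p q
    proof -
      have "(p, q) \<in> R (T, e) \<longleftrightarrow> p \<in> D \<and> q \<in> D \<and> \<psi> (T, e) p = \<psi> (T, e) q"
        unfolding R_def SD by simp
      also have "\<dots> \<longleftrightarrow> p \<in> D \<and> q \<in> D \<and> \<phi> p = \<phi> q"
        using S by auto
      also have "\<dots> \<longleftrightarrow> p \<in> D \<and> q \<in> D \<and> (p = q \<or> p \<in> {a, b} \<and> q \<in> {a, b})"
        using eq by blast
      also have "\<dots> \<longleftrightarrow> (p, q) \<in> Id_on D \<union> {(a, b), (b, a)}"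
        using D(4,5) by (auto simp: Id_on_def)
      finally show ?thesis .
    qed
    then have "R (T, e) = Id_on D \<union> {(a, b), (b, a)}"
      by (intro set_eqI) (metis surj_pair)
    then show "\<exists>E\<in>RX X. R E = Id_on D \<union> {(a, b), (b, a)}"
      using T(1) by blast
  qed
  then show ?thesis
    using that by (simp add: N_def K_def)
qed

end

section \<open>From identification of extensions to the order\<close>

text \<open>The inverse homeomorphism gives the second comparison; the hypothesis \<open>e\<close>
  ensures that it sends \<open>snd E x\<close> back to \<open>snd E' x\<close>.\<close>

lemma ext_equiv_imp_ext_le:
  assumes "ext_equiv X E E'" and e: "snd E' ` topspace X \<subseteq> topspace (fst E')"
  shows "ext_le X E E'" "ext_le X E' E"
proof -
  obtain f where f: "homeomorphic_map (fst E') (fst E) f" "\<And>x. x \<in> topspace X \<Longrightarrow> f (snd E' x) = snd E x"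
    using assms by (auto simp: ext_equiv_def)
  then show "ext_le X E E'"
    using homeomorphic_imp_continuous_map unfolding ext_le_def by blast
  obtain g where g: "homeomorphic_maps (fst E') (fst E) f g"
    using f(1) homeomorphic_map_maps by blast
  have "g (snd E x) = snd E' x" if "x \<in> topspace X" for x
  proof -
    have "g (f (snd E' x)) = snd E' x"
      using g e that by (auto simp: homeomorphic_maps_def)
    then show ?thesis
      using f(2)[OF that] by simp
  qed
  then show "ext_le X E' E"
    using g unfolding ext_le_def homeomorphic_maps_def by blast
qed

theorem theorem3p12:
  fixes X :: "'a topology" and Y :: "'b topology"
    and BX :: "'c topology" and eX :: "'a \<Rightarrow> 'c"
    and BY :: "'d topology" and eY :: "'b \<Rightarrow> 'd"
  assumes "completely_regular_space X" "Hausdorff_space X" "locally_compact_space X"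
    and "\<not> realcompact_space X"
    and "completely_regular_space Y" "Hausdorff_space Y" "locally_compact_space Y"
    and "\<not> realcompact_space Y"
    and "R_order_isomorphic X Y"
    and "stone_cech X BX eX" and "stone_cech Y BY eY"
  shows "subtopology BX ((topspace BX - eX ` topspace X)
            - BX closure_of (hewitt_set X BX eX - eX ` topspace X))
         homeomorphic_space
         subtopology BY ((topspace BY - eY ` topspace Y)
            - BY closure_of (hewitt_set Y BY eY - eY ` topspace Y))"
proof -
  interpret X: stone_cech_compactification X BX eX
    by unfold_locales fact
  interpret Y: stone_cech_compactification Y BY eY
    by unfold_locales fact
  obtain RX' where RX: "relation_order (RX X) (ext_le X) BX (topspace BX - eX ` topspace X)
      (BX closure_of (hewitt_set X BX eX - eX ` topspace X)) RX'"
    using X.relation_order_RX assms by blast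
  obtain RY' where RY: "relation_order (RX Y) (ext_le Y) BY (topspace BY - eY ` topspace Y)
      (BY closure_of (hewitt_set Y BY eY - eY ` topspace Y)) RY'"
    using Y.relation_order_RX assms by blast
  obtain F where F: "F ` RX X \<subseteq> RX Y"
      "\<And>a b. a \<in> RX X \<Longrightarrow> b \<in> RX X \<Longrightarrow> ext_le X a b \<longleftrightarrow> ext_le Y (F a) (F b)"
      "\<And>c. c \<in> RX Y \<Longrightarrow> \<exists>a\<in>RX X. ext_equiv Y (F a) c"
    using assms(9) unfolding R_order_isomorphic_def by blast
  \<comment> \<open>Surjectivity up to identification is turned into comparability in both
    directions, the form used by the abstract transfer.\<close>
  have "\<exists>a\<in>RX X. ext_le Y (F a) c \<and> ext_le Y c (F a)" if c: "c \<in> RX Y" for c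
  proof -
    obtain a where a: "a \<in> RX X" "ext_equiv Y (F a) c"
      using F(3)[OF c] by blast
    have "embedding_map Y (fst c) (snd c)"
      using c by (auto simp: RX_def is_extension_def)
    then have "continuous_map Y (fst c) (snd c)"
      using embedding_map_def continuous_map_in_subtopology homeomorphic_imp_continuous_map by metis
    then have "snd c ` topspace Y \<subseteq> topspace (fst c)"
      by (rule continuous_map_image_subset_topspace)
    then show ?thesis
      using ext_equiv_imp_ext_le[OF a(2)] a(1) by blast
  qed
  with RX RY F(1,2) show ?thesis
    by (rule relation_order_isomorphic_imp_homeomorphic)
qed

end
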